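(* Let $S$ denote the Shrikhande graph. For a positive integer $n$, there exists an $S$-design of order $n$ if and only if $n \equiv 1 \pmod{96}$.
   Context: The Shrikhande graph $S$ is the Cayley graph on the group $\mathbb{Z}_4 \times \mathbb{Z}_4$ with connection set $\{\pm(1,0), \pm(0,1), \pm(1,1)\}$. It is a 6-regular graph on 16 vertices with 48 edges, and it is strongly regular with parameters $(16,6,2,2)$. For simple graphs $F$ and $G$, a $G$-decomposition of $F$ is a partition of the edge set of $F$ into classes, each of which is the edge set of a subgraph of $F$ isomorphic to $G$. A $G$-design of order $n$ is a $G$-decomposition of the complete graph $K_n$; for $n=1$, the empty decomposition counts as a $G$-design. *)

theory Defs
  imports Main
begin

text \<open>A simple graph is given by a vertex set V and a symmetric irreflexive
adjacency relation E. Its edge set consists of the unordered pairs {u,v}.\<close>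

definition graph_edges :: "'a set \<Rightarrow> ('a \<Rightarrow> 'a \<Rightarrow> bool) \<Rightarrow> 'a set set" where
  "graph_edges V E = {{u, v} | u v. u \<in> V \<and> v \<in> V \<and> E u v}"

definition is_copy_edges ::
  "'a set \<Rightarrow> ('a \<Rightarrow> 'a \<Rightarrow> bool) \<Rightarrow> 'b set \<Rightarrow> 'b set set \<Rightarrow> bool" where
  "is_copy_edges VG EG VF B \<longleftrightarrow>
     (\<exists>f. inj_on f VG \<and> f ` VG \<subseteq> VF \<and> B = (\<lambda>e. f ` e) ` graph_edges VG EG)"

definition is_decomposition ::
  "'a set \<Rightarrow> ('a \<Rightarrow> 'a \<Rightarrow> bool) \<Rightarrow> 'b set \<Rightarrow> ('b \<Rightarrow> 'b \<Rightarrow> bool) \<Rightarrow> 'b set set set \<Rightarrow> bool" where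
  "is_decomposition VG EG VF EF D \<longleftrightarrow>
     (\<forall>B\<in>D. B \<noteq> {} \<and> is_copy_edges VG EG VF B) \<and>
     (\<forall>B\<in>D. \<forall>B'\<in>D. B \<noteq> B' \<longrightarrow> B \<inter> B' = {}) \<and>
     \<Union>D = graph_edges VF EF"

definition has_design :: "'a set \<Rightarrow> ('a \<Rightarrow> 'a \<Rightarrow> bool) \<Rightarrow> nat \<Rightarrow> bool" where
  "has_design VG EG n \<longleftrightarrow>
     (\<exists>D. is_decomposition VG EG {0..<n} (\<lambda>u v. u \<noteq> v) D)"

text \<open>The Shrikhande graph: Cayley graph on Z_4 x Z_4 with connection set
{+-(1,0), +-(0,1), +-(1,1)}.\<close>

definition shrikhande_V :: "(int \<times> int) set" where
  "shrikhande_V = {0..<4} \<times> {0..<4}"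

definition shrikhande_E :: "int \<times> int \<Rightarrow> int \<times> int \<Rightarrow> bool" where
  "shrikhande_E x y \<longleftrightarrow>
     ((fst y - fst x) mod 4, (snd y - snd x) mod 4)
       \<in> {(1, 0), (3, 0), (0, 1), (0, 3), (1, 1), (3, 3)}"

end

theory Submission
  imports Defs "HOL-Library.Product_Plus" "HOL-Library.Multiset"
begin

text \<open>
  Necessity is counting: every vertex has degree divisible by \<open>6\<close> and the number of edges is
  divisible by \<open>48\<close>.

  For sufficiency, \<open>K\<^sub>4\<^sub>,\<^sub>4\<^sub>,\<^sub>4\<^sub>,\<^sub>4\<close> is the union of two Shrikhande graphs, so giving weight \<open>4\<close> to
  the points of a group divisible design with blocks of size \<open>4\<close> and \<open>t\<close> groups of size \<open>24\<close>
  decomposes the complete multipartite graph with \<open>t\<close> parts of size \<open>96\<close>. For \<open>4 \<le> t \<le> 19\<close>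
  such designs come from explicit relative difference families. Filling the parts, extended by one
  common point, with designs of order \<open>97\<close> gives order \<open>96 * t + 1\<close>. The orders \<open>97\<close>, \<open>193\<close> and
  \<open>289\<close> are handled by explicit difference families of Shrikhande graphs. Every \<open>k \<ge> 20\<close> other than
  \<open>43\<close> is of the form \<open>4 * m + u + w\<close> with \<open>m\<close> coprime to \<open>6\<close> and \<open>u, w \<le> m\<close>; truncating two
  columns of the transversal design with \<open>6\<close> columns over \<open>\<int>\<^sub>m\<close> then yields order \<open>96 * k + 1\<close> from
  the smaller orders, the blocks having sizes \<open>4\<close>, \<open>5\<close> and \<open>6\<close>. For \<open>43 = 6 * 7 + 1\<close> one truncates
  the transversal design with \<open>7\<close> columns over \<open>\<int>\<^sub>7\<close>.
\<close>

section \<open>Decompositions\<close>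

text \<open>The covered edge set \<open>P\<close> is arbitrary and classes may be empty, so that
  decompositions of pieces on a common vertex set \<open>X\<close> can be glued. Nonemptiness of the
  classes is restored in \<open>has_design_of_S_complete\<close>.\<close>

definition decomposable ::
  "'a set \<Rightarrow> ('a \<Rightarrow> 'a \<Rightarrow> bool) \<Rightarrow> 'b set \<Rightarrow> 'b set set \<Rightarrow> bool" where
  "decomposable VG EG X P \<longleftrightarrow>
     (\<exists>D. (\<forall>B\<in>D. is_copy_edges VG EG X B) \<and>
          (\<forall>B\<in>D. \<forall>B'\<in>D. B \<noteq> B' \<longrightarrow> B \<inter> B' = {}) \<and> \<Union>D = P)"

section \<open>Edge sets and their images under injective maps\<close>

lemma graph_edgesI: "u \<in> V \<Longrightarrow> v \<in> V \<Longrightarrow> E u v \<Longrightarrow> {u, v} \<in> graph_edges V E"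
  unfolding graph_edges_def by blast

lemma doubleton_in_graph_edges:
  assumes "\<And>x y. E x y \<Longrightarrow> E y x"
  shows "{u, v} \<in> graph_edges V E \<longleftrightarrow> u \<in> V \<and> v \<in> V \<and> E u v"
  using assms by (auto simp: graph_edges_def doubleton_eq_iff)

lemma graph_edges_subset_Pow: "graph_edges V E \<subseteq> Pow V"
  by (auto simp: graph_edges_def)

lemma graph_edges_cong:
  "(\<And>u v. u \<in> V \<Longrightarrow> v \<in> V \<Longrightarrow> E u v \<longleftrightarrow> E' u v) \<Longrightarrow> graph_edges V E = graph_edges V E'"
  by (auto simp: graph_edges_def)

lemma graph_edges_restrict:
  assumes "Y \<subseteq> X" "\<And>u v. u \<in> X \<Longrightarrow> v \<in> X \<Longrightarrow> E u v \<Longrightarrow> u \<in> Y \<and> v \<in> Y"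
  shows "graph_edges X E = graph_edges Y E"
proof -
  have "(u \<in> X \<and> v \<in> X \<and> E u v) = (u \<in> Y \<and> v \<in> Y \<and> E u v)" for u v
    using assms by blast
  then show ?thesis unfolding graph_edges_def by simp
qed

lemma image_graph_edges:
  assumes "\<And>u v. u \<in> V \<Longrightarrow> v \<in> V \<Longrightarrow> E u v \<longleftrightarrow> E' (f u) (f v)"
  shows "(`) f ` graph_edges V E = graph_edges (f ` V) E'"
proof
  show "(`) f ` graph_edges V E \<subseteq> graph_edges (f ` V) E'"
    using assms by (force simp: graph_edges_def)
  show "graph_edges (f ` V) E' \<subseteq> (`) f ` graph_edges V E"
  proof
    fix e assume "e \<in> graph_edges (f ` V) E'"
    then obtain u v where "u \<in> V" "v \<in> V" "E' (f u) (f v)" "e = f ` {u, v}"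
      by (auto simp: graph_edges_def)
    then show "e \<in> (`) f ` graph_edges V E"
      using assms by (intro image_eqI[of _ _ "{u, v}"] graph_edgesI) auto
  qed
qed

lemma is_copy_edges_subset_Pow: "is_copy_edges VG EG X B \<Longrightarrow> B \<subseteq> Pow X"
  unfolding is_copy_edges_def using graph_edges_subset_Pow[of VG EG] by blast

lemma is_copy_edges_image:
  assumes "is_copy_edges VG EG X B" "inj_on g X" "g ` X \<subseteq> Y"
  shows "is_copy_edges VG EG Y ((`) g ` B)"
proof -
  obtain f where f: "inj_on f VG" "f ` VG \<subseteq> X" "B = (\<lambda>e. f ` e) ` graph_edges VG EG"
    using assms(1) by (auto simp: is_copy_edges_def)
  have "inj_on (g \<circ> f) VG"
    using f assms(2) by (meson comp_inj_on inj_on_subset)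
  moreover have "(g \<circ> f) ` VG \<subseteq> Y" using f assms(3) by fastforce
  moreover have "(`) g ` B = (\<lambda>e. (g \<circ> f) ` e) ` graph_edges VG EG"
    unfolding f(3) by (auto simp: image_comp image_image)
  ultimately show ?thesis unfolding is_copy_edges_def by blast
qed

text \<open>An injection on \<open>X\<close> induces an injection on the subsets of
  \<open>X\<close>, hence on edges, so disjoint classes stay disjoint.\<close>

lemma decomposable_image:
  assumes "decomposable VG EG X P" "inj_on g X" "g ` X \<subseteq> Y"
  shows "decomposable VG EG Y ((`) g ` P)"
proof -
  obtain D where D: "\<forall>B\<in>D. is_copy_edges VG EG X B"
      "\<forall>B\<in>D. \<forall>B'\<in>D. B \<noteq> B' \<longrightarrow> B \<inter> B' = {}" "\<Union>D = P"
    using assms(1) by (auto simp: decomposable_def)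
  let ?h = "(`) ((`) g)"
  have inj: "inj_on ((`) g) (Pow X)" by (rule inj_on_image_Pow[OF assms(2)])
  have sub: "B \<subseteq> Pow X" if "B \<in> D" for B
    using is_copy_edges_subset_Pow D(1) that by blast
  have "\<forall>B\<in>?h ` D. is_copy_edges VG EG Y B"
    using D(1) is_copy_edges_image[OF _ assms(2,3)] by blast
  moreover have "\<forall>B\<in>?h ` D. \<forall>B'\<in>?h ` D. B \<noteq> B' \<longrightarrow> B \<inter> B' = {}"
  proof (intro ballI impI)
    fix C C' assume "C \<in> ?h ` D" "C' \<in> ?h ` D" and ne: "C \<noteq> C'"
    then obtain B B' where B: "B \<in> D" "B' \<in> D" "C = ?h B" "C' = ?h B'" by blast
    then have "B \<inter> B' = {}" using D(2) ne by metis
    moreover have "?h B \<inter> ?h B' = ?h (B \<inter> B')"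
      using inj_on_image_Int[OF inj sub sub] B by simp
    ultimately show "C \<inter> C' = {}" using B by simp
  qed
  moreover have "\<Union>(?h ` D) = (`) g ` P" using D(3) by blast
  ultimately show ?thesis unfolding decomposable_def by blast
qed

lemma decomposable_empty: "decomposable VG EG X {}"
  unfolding decomposable_def by blast

section \<open>Unions of decompositions\<close>

lemma decomposable_UN:
  assumes "\<And>i. i \<in> I \<Longrightarrow> decomposable VG EG X (P i)"
    and "\<And>i j. i \<in> I \<Longrightarrow> j \<in> I \<Longrightarrow> i \<noteq> j \<Longrightarrow> P i \<inter> P j = {}"
  shows "decomposable VG EG X (\<Union>i\<in>I. P i)"
proof -
  have "\<forall>i\<in>I. \<exists>D. (\<forall>B\<in>D. is_copy_edges VG EG X B) \<and>
          (\<forall>B\<in>D. \<forall>B'\<in>D. B \<noteq> B' \<longrightarrow> B \<inter> B' = {}) \<and> \<Union>D = P i"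
    using assms(1) unfolding decomposable_def by blast
  then obtain D where D: "\<And>i. i \<in> I \<Longrightarrow> (\<forall>B\<in>D i. is_copy_edges VG EG X B) \<and>
          (\<forall>B\<in>D i. \<forall>B'\<in>D i. B \<noteq> B' \<longrightarrow> B \<inter> B' = {}) \<and> \<Union>(D i) = P i"
    by metis
  have "B \<inter> B' = {}" if "i \<in> I" "j \<in> I" "B \<in> D i" "B' \<in> D j" "B \<noteq> B'" for i j B B'
  proof (cases "i = j")
    case True then show ?thesis using D that by blast
  next
    case False
    then have "P i \<inter> P j = {}" using assms(2) that by blast
    moreover have "B \<subseteq> P i" "B' \<subseteq> P j" using D that by blast+
    ultimately show ?thesis by blast
  qed
  then have "\<forall>B\<in>\<Union>(D ` I). \<forall>B'\<in>\<Union>(D ` I). B \<noteq> B' \<longrightarrow> B \<inter> B' = {}" by blast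
  moreover have "\<forall>B\<in>\<Union>(D ` I). is_copy_edges VG EG X B" using D by blast
  moreover have "\<Union>(\<Union>(D ` I)) = (\<Union>i\<in>I. \<Union>(D i))" by blast
  moreover have "\<dots> = (\<Union>i\<in>I. P i)" using D by simp
  ultimately show ?thesis unfolding decomposable_def by metis
qed

text \<open>Edge sets are presented by symmetric relations that partition \<open>E\<close> on
  \<open>X\<close>; disjointness then reduces to uniqueness of the index for an ordered pair of
  vertices.\<close>

lemma decomposable_relation_UN:
  assumes "\<And>i. i \<in> I \<Longrightarrow> decomposable VG EG X (graph_edges X (R i))"
    and sym: "\<And>i x y. i \<in> I \<Longrightarrow> R i x y \<Longrightarrow> R i y x"
    and ex: "\<And>x y. x \<in> X \<Longrightarrow> y \<in> X \<Longrightarrow> E x y \<longleftrightarrow> (\<exists>i\<in>I. R i x y)"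
    and uniq: "\<And>i j x y. i \<in> I \<Longrightarrow> j \<in> I \<Longrightarrow> x \<in> X \<Longrightarrow> y \<in> X \<Longrightarrow> R i x y \<Longrightarrow> R j x y \<Longrightarrow> i = j"
  shows "decomposable VG EG X (graph_edges X E)"
proof -
  have "graph_edges X E = (\<Union>i\<in>I. graph_edges X (R i))"
    using ex by (fastforce simp: graph_edges_def)
  moreover have "graph_edges X (R i) \<inter> graph_edges X (R j) = {}" if "i \<in> I" "j \<in> I" "i \<noteq> j" for i j
  proof -
    { fix e assume "e \<in> graph_edges X (R i)" "e \<in> graph_edges X (R j)"
      then obtain u v where "u \<in> X" "v \<in> X" "R i u v" "{u, v} \<in> graph_edges X (R j)"
        by (auto simp: graph_edges_def)
      moreover from this have "R j u v" using sym[OF that(2)] doubleton_in_graph_edges[of "R j"] by blast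
      ultimately have False using uniq that by blast }
    then show ?thesis by blast
  qed
  ultimately show ?thesis using decomposable_UN[of I] assms(1) by metis
qed

section \<open>Transport to other vertex sets\<close>

lemma decomposable_transfer:
  assumes "decomposable VG EG X (graph_edges X E)" "bij_betw g X Y" "Y \<subseteq> Z"
    and "\<And>x y. x \<in> X \<Longrightarrow> y \<in> X \<Longrightarrow> E x y \<longleftrightarrow> E' (g x) (g y)"
  shows "decomposable VG EG Z (graph_edges Y E')"
proof -
  have "g ` X = Y" "inj_on g X" using assms(2) by (auto simp: bij_betw_def)
  then show ?thesis
    using decomposable_image[OF assms(1), of g Z] assms(3) image_graph_edges[of X E E' g] assms(4) by simp
qed

text \<open>Complete graphs of equal order are isomorphic. The larger set \<open>Z\<close> lets
  pieces with different vertex sets live on one common vertex set.\<close>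

lemma decomposable_complete_transfer:
  assumes "decomposable VG EG X (graph_edges X (\<noteq>))" "finite X" "finite Y" "card X = card Y" "Y \<subseteq> Z"
  shows "decomposable VG EG Z (graph_edges Y (\<noteq>))"
proof -
  obtain g where g: "bij_betw g X Y" using assms finite_same_card_bij by blast
  then show ?thesis
    using assms by (intro decomposable_transfer[OF assms(1) g]) (auto simp: bij_betw_def inj_on_eq_iff)
qed

lemma decomposable_multipartite_transfer:
  assumes "decomposable VG EG (T \<times> W) (graph_edges (T \<times> W) (\<lambda>p q. fst p \<noteq> fst q))"
    and "finite T" "finite T'" "card T = card T'" "finite W" "finite W'" "card W = card W'"
    and "T' \<times> W' \<subseteq> Z"
  shows "decomposable VG EG Z (graph_edges (T' \<times> W') (\<lambda>p q. fst p \<noteq> fst q))"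
proof -
  obtain g where g: "bij_betw g T T'" using assms finite_same_card_bij by blast
  obtain h where h: "bij_betw h W W'" using assms finite_same_card_bij by blast
  have "bij_betw (map_prod g h) (T \<times> W) (T' \<times> W')"
    using g h by (rule bij_betw_map_prod)
  then show ?thesis
    using g assms(8) by (intro decomposable_transfer[OF assms(1)]) (auto simp: bij_betw_def inj_on_eq_iff)
qed

text \<open>Weighting as in Wilson's fundamental construction: each vertex of \<open>X\<close> is
  replaced by a copy of \<open>W\<close>, so every block becomes a copy of the blow-up of
  \<open>(VK, EK)\<close>, which is decomposed by assumption.\<close>

lemma decomposable_weighted:
  assumes "decomposable VK EK X (graph_edges X E)"
    and symK: "\<And>x y. EK x y \<Longrightarrow> EK y x"
    and sym: "\<And>x y. E x y \<Longrightarrow> E y x"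
    and "decomposable VG EG (VK \<times> W) (graph_edges (VK \<times> W) (\<lambda>p q. EK (fst p) (fst q)))"
  shows "decomposable VG EG (X \<times> W) (graph_edges (X \<times> W) (\<lambda>p q. E (fst p) (fst q)))"
proof -
  obtain D where D: "\<And>B. B \<in> D \<Longrightarrow> is_copy_edges VK EK X B"
      "\<And>B B'. B \<in> D \<Longrightarrow> B' \<in> D \<Longrightarrow> B \<noteq> B' \<Longrightarrow> B \<inter> B' = {}" "\<Union>D = graph_edges X E"
    using assms(1) unfolding decomposable_def by metis
  \<comment> \<open>An edge of the blow-up is assigned to the unique block containing its
    projection.\<close>
  show ?thesis
  proof (rule decomposable_relation_UN[where I = D and R = "\<lambda>B p q. {fst p, fst q} \<in> B"])
    fix B assume B: "B \<in> D"
    obtain f where f: "inj_on f VK" "f ` VK \<subseteq> X" "B = (\<lambda>e. f ` e) ` graph_edges VK EK"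
      using D(1)[OF B] by (auto simp: is_copy_edges_def)
    have inB: "{f u, f v} \<in> B \<longleftrightarrow> EK u v" if "u \<in> VK" "v \<in> VK" for u v
    proof
      assume "{f u, f v} \<in> B"
      then obtain e where e: "e \<in> graph_edges VK EK" "f ` {u, v} = f ` e" unfolding f(3) by auto
      then have "{u, v} = e"
        using inj_on_image_eq_iff[OF f(1), of "{u, v}" e] that graph_edges_subset_Pow[of VK EK] by blast
      then show "EK u v" using e(1) doubleton_in_graph_edges[of EK] symK by blast
    next
      assume "EK u v"
      then show "{f u, f v} \<in> B"
        unfolding f(3) using that by (intro image_eqI[of _ _ "{u, v}"] graph_edgesI) auto
    qed
    have "decomposable VG EG (X \<times> W) (graph_edges (f ` VK \<times> W) (\<lambda>p q. {fst p, fst q} \<in> B))"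
    proof (rule decomposable_transfer[OF assms(4)])
      show "bij_betw (map_prod f id) (VK \<times> W) (f ` VK \<times> W)"
        using f(1) by (intro bij_betw_map_prod) (auto simp: bij_betw_def)
    qed (use f(2) inB in auto)
    moreover have "graph_edges (f ` VK \<times> W) (\<lambda>p q. {fst p, fst q} \<in> B) =
      graph_edges (X \<times> W) (\<lambda>p q. {fst p, fst q} \<in> B)"
    proof -
      have "x \<in> f ` VK \<and> y \<in> f ` VK" if "{x, y} \<in> B" for x y
        using that graph_edges_subset_Pow[of VK EK] unfolding f(3) by blast
      then show ?thesis using f(2) by (intro graph_edges_restrict[symmetric]) auto
    qed
    ultimately show "decomposable VG EG (X \<times> W) (graph_edges (X \<times> W) (\<lambda>p q. {fst p, fst q} \<in> B))"
      by simp
  next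
    fix p q assume "p \<in> X \<times> W" "q \<in> X \<times> W"
    then show "E (fst p) (fst q) \<longleftrightarrow> (\<exists>B\<in>D. {fst p, fst q} \<in> B)"
      using D(3) doubleton_in_graph_edges[of E "fst p" "fst q" X] sym by auto
  qed (use D(2) in \<open>auto simp: insert_commute\<close>)
qed

section \<open>Difference families\<close>

text \<open>The group is the set of representatives \<open>range q\<close>, where \<open>q\<close> reduces modulo a subgroup.\<close>

lemma decomposable_difference_family:
  fixes q :: "'g::ab_group_add \<Rightarrow> 'g" and f :: "'i \<Rightarrow> 'v \<Rightarrow> 'g"
  assumes q: "\<And>x y. q (x + q y) = q (x + y)"
    and symG: "\<And>u v. EG u v \<Longrightarrow> EG v u"
    and inj: "\<And>i u v. i \<in> I \<Longrightarrow> u \<in> VG \<Longrightarrow> v \<in> VG \<Longrightarrow> q (f i u) = q (f i v) \<Longrightarrow> u = v"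
    and bij: "bij_betw (\<lambda>(i, u, v). q (f i u - f i v)) {(i, u, v). i \<in> I \<and> u \<in> VG \<and> v \<in> VG \<and> EG u v} N"
  shows "decomposable VG EG (range q) (graph_edges (range q) (\<lambda>x y. q (x - y) \<in> N))"
proof -
  \<comment> \<open>The single law for \<open>q\<close> yields the calculus of reduction modulo a
    subgroup: \<open>q\<close> is idempotent, may be dropped inside sums and differences, and
    translations can be cancelled.\<close>
  have q0: "q (q x) = q x" for x using q[of 0 x] by simp
  have qadd: "q (q x + y) = q (x + y)" for x y using q[of y x] by (simp add: add.commute)
  have qneg: "q (x - q y) = q (x - y)" for x y
    using q[of "x - y - q y" y] by (simp add: algebra_simps)
  have qdiff: "q (q x - y) = q (x - y)" for x y using qadd[of x "- y"] by simp
  have qcong: "q (x + z) = q (y + z)" if "q x = q y" for x y z using that qadd by metis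
  have qcancel: "q x = q y" if "q (x + z) = q (y + z)" for x y z
    using qcong[OF that, of "- z"] by simp
  have qcancel2: "q x = q y" if "q (z + x) = q (z + y)" for x y z
    using qcancel[of x z y] that by (simp add: add.commute)
  \<comment> \<open>Base block \<open>i\<close> translated by \<open>t\<close>; \<open>K\<close>
    indexes all translates, and \<open>R k\<close> is the adjacency relation of translate
    \<open>k\<close>.\<close>
  define g where "g = (\<lambda>(i, t) u. q (f i u + t))"
  define K where "K = I \<times> range q"
  define R where "R = (\<lambda>k x y. \<exists>u\<in>VG. \<exists>v\<in>VG. EG u v \<and> x = g k u \<and> y = g k v)"
  have gdiff: "q (g (i, t) u - g (i, t) v) = q (f i u - f i v)" for i t u v
    unfolding g_def by (simp add: qdiff qneg)
  show ?thesis
  proof (rule decomposable_relation_UN[where I = K and R = R])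
    fix k assume "k \<in> K"
    then obtain i t where k: "k = (i, t)" "i \<in> I" unfolding K_def by auto
    have "inj_on (g k) VG"
    proof (rule inj_onI)
      fix u v assume uv: "u \<in> VG" "v \<in> VG" "g k u = g k v"
      then have "q (f i u) = q (f i v)" unfolding k g_def by (auto dest: qcancel)
      then show "u = v" using inj k(2) uv by blast
    qed
    moreover have "g k ` VG \<subseteq> range q" unfolding k g_def by auto
    moreover have "graph_edges (range q) (R k) = (\<lambda>e. g k ` e) ` graph_edges VG EG"
    proof -
      have "graph_edges (range q) (R k) = graph_edges (g k ` VG) (R k)"
        using calculation(2) by (intro graph_edges_restrict) (auto simp: R_def)
      also have "\<dots> = (\<lambda>e. g k ` e) ` graph_edges VG EG"
        by (rule image_graph_edges[symmetric])
          (use \<open>inj_on (g k) VG\<close> in \<open>auto simp: R_def dest: inj_onD\<close>)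
      finally show ?thesis .
    qed
    ultimately have "is_copy_edges VG EG (range q) (graph_edges (range q) (R k))"
      unfolding is_copy_edges_def by blast
    then show "decomposable VG EG (range q) (graph_edges (range q) (R k))"
      unfolding decomposable_def by (intro exI[of _ "{graph_edges (range q) (R k)}"]) auto
  next
    fix x y assume xy: "x \<in> range q" "y \<in> range q"
    then have qxy: "q x = x" "q y = y" using q0 by auto
    show "q (x - y) \<in> N \<longleftrightarrow> (\<exists>k\<in>K. R k x y)"
    proof
      assume "q (x - y) \<in> N"
      then obtain i u v where iuv: "i \<in> I" "u \<in> VG" "v \<in> VG" "EG u v" "q (f i u - f i v) = q (x - y)"
        using bij unfolding bij_betw_def by (force simp: image_iff)
      \<comment> \<open>The translation carrying vertex \<open>u\<close> of base block
        \<open>i\<close> to \<open>x\<close>; equality of the differences then forces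
        \<open>v\<close> to go to \<open>y\<close>.\<close>
      define t where "t = q (x - f i u)"
      have "g (i, t) u = x" unfolding g_def t_def by (simp add: q qxy)
      moreover have "g (i, t) v = y"
      proof -
        have "g (i, t) v = q (x - (f i u - f i v))"
          unfolding g_def t_def by (simp add: q algebra_simps)
        also have "\<dots> = q (x - (x - y))" using iuv(5) qneg by metis
        finally show ?thesis using qxy by simp
      qed
      ultimately have "R (i, t) x y" unfolding R_def using iuv(2-4) by blast
      moreover have "(i, t) \<in> K" using iuv(1) by (simp add: K_def t_def)
      ultimately show "\<exists>k\<in>K. R k x y" by blast
    next
      assume "\<exists>k\<in>K. R k x y"
      then show "q (x - y) \<in> N"
        using bij gdiff unfolding K_def R_def bij_betw_def by (force simp: image_iff)
    qed
  next
    fix k l x y assume "k \<in> K" "l \<in> K" "R k x y" "R l x y"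
    then obtain i t u v j s u' v' where *: "k = (i, t)" "l = (j, s)" "i \<in> I" "j \<in> I"
      "t \<in> range q" "s \<in> range q"
      "u \<in> VG" "v \<in> VG" "EG u v" "u' \<in> VG" "v' \<in> VG" "EG u' v'"
      "x = g (i, t) u" "y = g (i, t) v" "x = g (j, s) u'" "y = g (j, s) v'"
      unfolding K_def R_def by (auto 0 3)
    \<comment> \<open>Translates keep differences, so \<open>bij\<close> recovers the base block and
      the edge; cancelling the image of \<open>u\<close> recovers the translation.\<close>
    have "q (f i u - f i v) = q (f j u' - f j v')" using gdiff * by metis
    then have "(i, u, v) = (j, u', v')"
      using inj_onD[OF bij_betw_imp_inj_on[OF bij], of "(i, u, v)" "(j, u', v')"] * by auto
    moreover from this have "q (f i u + t) = q (f i u + s)" using * unfolding g_def by simp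
    then have "q t = q s" by (rule qcancel2)
    then have "t = s" using * q0 by auto
    ultimately show "k = l" using * by simp
  qed (auto simp: R_def dest: symG)
qed

section \<open>The Shrikhande graph\<close>

abbreviation multipartite :: "'a set \<Rightarrow> 'b set \<Rightarrow> ('a \<times> 'b) set set" where
  "multipartite T W \<equiv> graph_edges (T \<times> W) (\<lambda>p q. fst p \<noteq> fst q)"

abbreviation S_decomposable :: "'b set \<Rightarrow> 'b set set \<Rightarrow> bool" where
  "S_decomposable \<equiv> decomposable shrikhande_V shrikhande_E"

text \<open>The connection set is closed under negation modulo 4.\<close>

lemma shrikhande_E_sym: "shrikhande_E x y \<Longrightarrow> shrikhande_E y x"
proof -
  have neg: "(c - d) mod 4 = (4 - (d - c) mod 4) mod 4" for c d :: int
  proof -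
    have "(4 - (d - c) mod 4) mod 4 = (4 + (c - d)) mod 4" unfolding mod_diff_right_eq by simp
    then show ?thesis by (simp only: mod_add_self1)
  qed
  assume xy: "shrikhande_E x y"
  have "\<forall>z \<in> {(1, 0), (3, 0), (0, 1), (0, 3), (1, 1), (3 :: int, 3 :: int)}.
    ((4 - fst z) mod 4, (4 - snd z) mod 4) \<in> {(1, 0), (3, 0), (0, 1), (0, 3), (1, 1), (3, 3)}"
    by simp
  from bspec[OF this xy[unfolded shrikhande_E_def]] show "shrikhande_E y x"
    unfolding shrikhande_E_def neg[of "fst x" "fst y"] neg[of "snd x" "snd y"] fst_conv snd_conv .
qed

text \<open>On \<open>\<int>\<^sub>4 \<times> \<int>\<^sub>4\<close> the twelve differences outside \<open>2\<int>\<^sub>4 \<times> 2\<int>\<^sub>4\<close> split into the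
  connection set of the Shrikhande graph and its image under the automorphism with matrix
  \<open>(1, 2; 2, 3)\<close>, so \<open>K\<^sub>4\<^sub>,\<^sub>4\<^sub>,\<^sub>4\<^sub>,\<^sub>4\<close> is the union of two Shrikhande graphs.\<close>

lemma S_decomposable_K4444: "S_decomposable ({0..<4::nat} \<times> {0..<4::nat}) (multipartite {0..<4} {0..<4})"
proof -
  define \<phi> :: "int \<times> int \<Rightarrow> int \<times> int" where
    "\<phi> = (\<lambda>(x, y). ((x + 2 * y) mod 4, (2 * x + 3 * y) mod 4))"
  define R where "R = (\<lambda>(i::nat) x y. if i = 0 then shrikhande_E x y else shrikhande_E (\<phi> x) (\<phi> y))"
  have V: "shrikhande_V = set (List.product [0..3] [0..3])"
    by (auto simp: shrikhande_V_def)
  \<comment> \<open>The matrix of \<phi> squares to the identity modulo 4.\<close>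
  have \<phi>\<phi>: "\<phi> (\<phi> x) = x" and \<phi>V: "\<phi> x \<in> shrikhande_V" if "x \<in> shrikhande_V" for x
  proof -
    have "\<forall>x\<in>shrikhande_V. \<phi> (\<phi> x) = x \<and> \<phi> x \<in> shrikhande_V"
      unfolding V \<phi>_def by code_simp
    then show "\<phi> (\<phi> x) = x" "\<phi> x \<in> shrikhande_V" using that by auto
  qed
  have bij: "bij_betw \<phi> shrikhande_V shrikhande_V"
    using \<phi>\<phi> \<phi>V by (intro bij_betw_byWitness[where f' = \<phi>]) auto
  have split: "\<forall>x\<in>shrikhande_V. \<forall>y\<in>shrikhande_V.
      (fst x mod 2 \<noteq> fst y mod 2 \<or> snd x mod 2 \<noteq> snd y mod 2 \<longleftrightarrow> shrikhande_E x y \<or> shrikhande_E (\<phi> x) (\<phi> y)) \<and>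
      \<not> (shrikhande_E x y \<and> shrikhande_E (\<phi> x) (\<phi> y))"
    unfolding V \<phi>_def shrikhande_E_def by code_simp
  have copy: "S_decomposable shrikhande_V (graph_edges shrikhande_V shrikhande_E)"
  proof -
    have "is_copy_edges shrikhande_V shrikhande_E shrikhande_V (graph_edges shrikhande_V shrikhande_E)"
      unfolding is_copy_edges_def by (intro exI[of _ id]) auto
    then show ?thesis
      unfolding decomposable_def by (intro exI[of _ "{graph_edges shrikhande_V shrikhande_E}"]) auto
  qed
  have dec: "S_decomposable shrikhande_V
    (graph_edges shrikhande_V (\<lambda>x y. fst x mod 2 \<noteq> fst y mod 2 \<or> snd x mod 2 \<noteq> snd y mod 2))"
  proof (rule decomposable_relation_UN[where I = "{0, 1}" and R = R])
    fix i :: nat assume "i \<in> {0, 1}"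
    moreover have "S_decomposable shrikhande_V
        (graph_edges shrikhande_V (\<lambda>x y. shrikhande_E (\<phi> x) (\<phi> y)))"
      by (rule decomposable_transfer[OF copy bij]) (auto simp: \<phi>\<phi>)
    ultimately show "S_decomposable shrikhande_V (graph_edges shrikhande_V (R i))"
      using copy by (auto simp: R_def)
  next
    fix x y assume "x \<in> shrikhande_V" "y \<in> shrikhande_V"
    then show "(fst x mod 2 \<noteq> fst y mod 2 \<or> snd x mod 2 \<noteq> snd y mod 2) \<longleftrightarrow> (\<exists>i\<in>{0, 1}. R i x y)"
      using split by (auto simp: R_def)
  next
    fix i j :: nat and x y assume "i \<in> {0, 1}" "j \<in> {0, 1}" "x \<in> shrikhande_V" "y \<in> shrikhande_V"
      "R i x y" "R j x y"
    then show "i = j" using split by (auto simp: R_def split: if_splits)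
  qed (auto simp: R_def shrikhande_E_sym split: if_splits)
  \<comment> \<open>The two parities name the coset of the subgroup of even elements, which is the
    part of the multipartite graph; the halves name the position within that part.\<close>
  let ?g = "\<lambda>(x::int, y::int). (nat (2 * (x mod 2) + y mod 2), nat (2 * (x div 2) + y div 2))"
  let ?g' = "\<lambda>(s::nat, t::nat). (2 * (int t div 2) + int s div 2, 2 * (int t mod 2) + int s mod 2)"
  have "bij_betw ?g shrikhande_V ({0..<4} \<times> {0..<4})"
  proof (rule bij_betw_byWitness[where f' = ?g'])
    show "\<forall>x\<in>shrikhande_V. ?g' (?g x) = x" unfolding V by code_simp
    show "\<forall>y\<in>{0..<4} \<times> {0..<4}. ?g (?g' y) = y" by code_simp
    show "?g ` shrikhande_V \<subseteq> {0..<4} \<times> {0..<4}" unfolding V by code_simp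
    show "?g' ` ({0..<4} \<times> {0..<4}) \<subseteq> shrikhande_V" unfolding V by code_simp
  qed
  moreover have "\<forall>x\<in>shrikhande_V. \<forall>y\<in>shrikhande_V.
      (fst x mod 2 \<noteq> fst y mod 2 \<or> snd x mod 2 \<noteq> snd y mod 2) = (fst (?g x) \<noteq> fst (?g y))"
    unfolding V by code_simp
  ultimately show ?thesis
    by (intro decomposable_transfer[OF dec]) blast+
qed

section \<open>Difference families in products of two cyclic groups\<close>

fun merge :: "int list \<Rightarrow> int list \<Rightarrow> int list" where
  "merge [] ys = ys"
| "merge xs [] = xs"
| "merge (x # xs) (y # ys) = (if x \<le> y then x # merge xs (y # ys) else y # merge (x # xs) ys)"

fun merge_pairs :: "int list list \<Rightarrow> int list list" where
  "merge_pairs (xs # ys # zss) = merge xs ys # merge_pairs zss"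
| "merge_pairs zss = zss"

lemma length_merge_pairs [termination_simp]: "length (merge_pairs zss) \<le> length zss"
  by (induction zss rule: merge_pairs.induct) auto

fun merge_all :: "int list list \<Rightarrow> int list" where
  "merge_all [] = []"
| "merge_all [xs] = xs"
| "merge_all (xs # ys # zss) = merge_all (merge xs ys # merge_pairs zss)"

lemma mset_merge: "mset (merge xs ys) = mset xs + mset ys"
  by (induction xs ys rule: merge.induct) auto

lemma mset_merge_pairs: "mset (concat (merge_pairs zss)) = mset (concat zss)"
  by (induction zss rule: merge_pairs.induct) (auto simp: mset_merge)

lemma mset_merge_all: "mset (merge_all zss) = mset (concat zss)"
  by (induction zss rule: merge_all.induct) (auto simp: mset_merge mset_merge_pairs)

text \<open>Bottom-up merging suits evaluation by \<open>code_simp\<close> on lists of up to several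
  hundred differences. Preservation of the multiset transfers distinctness and the set of values
  from the sorted list back to the input.\<close>

definition merge_sort :: "int list \<Rightarrow> int list" where
  "merge_sort xs = merge_all (map (\<lambda>x. [x]) xs)"

lemma mset_merge_sort: "mset (merge_sort xs) = mset xs"
  by (simp add: merge_sort_def mset_merge_all)

text \<open>The element \<open>(x, y)\<close> of \<open>\<int>\<^sub>a \<times> \<int>\<^sub>b\<close> is encoded as the integer \<open>x * b + y\<close>.\<close>

definition differences ::
  "int \<Rightarrow> int \<Rightarrow> ('v \<Rightarrow> nat) \<Rightarrow> ('v \<times> 'v) list \<Rightarrow> (int \<times> int) list list \<Rightarrow> int list" where
  "differences a b ix es Bs = concat (map (\<lambda>B. map (\<lambda>(u, v).
     (fst (B ! ix u) - fst (B ! ix v)) mod a * b + (snd (B ! ix u) - snd (B ! ix v)) mod b) es) Bs)"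

text \<open>Computable form of the difference family lemma, relative to the subgroup of pairs
  divisible by \<open>a'\<close> and \<open>b'\<close>. The list equation \<open>diffs\<close> says
  at once that no difference lies in the subgroup and that every other element occurs exactly
  once.\<close>

lemma decomposable_bicyclic_difference_family:
  fixes a b a' b' :: int and vs :: "'v list"
  assumes pos: "0 < a" "0 < b" and dvd: "a' dvd a" "b' dvd b"
    and sym: "\<And>u v. E u v \<Longrightarrow> E v u"
    and inj: "\<forall>B\<in>set Bs. distinct (map (\<lambda>v. (fst (B ! ix v) mod a, snd (B ! ix v) mod b)) vs)"
    and diffs: "merge_sort (differences a b ix (filter (\<lambda>(u, v). E u v) (List.product vs vs)) Bs) =
      filter (\<lambda>d. \<not> (a' dvd d div b \<and> b' dvd d mod b)) [0..a * b - 1]"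
  shows "decomposable (set vs) E ({0..<a} \<times> {0..<b})
    (graph_edges ({0..<a} \<times> {0..<b}) (\<lambda>x y. \<not> (a' dvd fst x - fst y \<and> b' dvd snd x - snd y)))"
proof -
  define q :: "int \<times> int \<Rightarrow> int \<times> int" where "q = (\<lambda>x. (fst x mod a, snd x mod b))"
  define G where "G = {0..<a} \<times> {0..<b}"
  define N where "N = {d \<in> G. \<not> (a' dvd fst d \<and> b' dvd snd d)}"
  define enc :: "int \<times> int \<Rightarrow> int" where "enc = (\<lambda>d. fst d * b + snd d)"
  define \<delta> :: "(int \<times> int) list \<times> 'v \<times> 'v \<Rightarrow> int \<times> int" where
    "\<delta> = (\<lambda>(B, u, v). q (B ! ix u - B ! ix v))"
  define L where "L = concat (map (\<lambda>B. map (Pair B) (filter (\<lambda>(u, v). E u v) (List.product vs vs))) Bs)"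
  have range: "range q = G"
  proof
    show "range q \<subseteq> G" using pos by (auto simp: q_def G_def)
    have "q x = x" if "x \<in> G" for x using that by (auto simp: q_def G_def)
    then show "G \<subseteq> range q" by (metis rangeI subsetI)
  qed
  have q: "q (x + q y) = q (x + y)" for x y by (simp add: q_def mod_simps)
  have \<delta>G: "\<delta> ` set L \<subseteq> G" using range by (auto simp: \<delta>_def)
  have enc: "enc d div b = fst d" "enc d mod b = snd d" if "d \<in> G" for d
    using that by (auto simp: enc_def G_def)
  have inj_enc: "inj_on enc G"
    using enc by (intro inj_onI prod_eqI) metis+
  \<comment> \<open>Mixed radix representation: the encoding is onto an initial segment of the
    integers, so differences can be compared with an interval.\<close>
  have encG: "enc ` G = {0..a * b - 1}"
  proof
    have "fst d * b + snd d \<le> a * b - 1" if "d \<in> G" for d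
    proof -
      have "(fst d + 1) * b \<le> a * b" using that pos by (intro mult_right_mono) (auto simp: G_def)
      then show ?thesis using that by (auto simp: G_def algebra_simps)
    qed
    then show "enc ` G \<subseteq> {0..a * b - 1}" using pos by (auto simp: enc_def G_def)
    show "{0..a * b - 1} \<subseteq> enc ` G"
    proof
      fix e assume e: "e \<in> {0..a * b - 1}"
      have "e div b * b \<le> e" using div_mult_mod_eq[of e b] pos_mod_sign[OF pos(2), of e] by linarith
      then have "e div b * b < a * b" using e by simp
      then have "e div b < a" using pos by simp
      then show "e \<in> enc ` G"
        using e pos by (intro image_eqI[of _ _ "(e div b, e mod b)"]) (auto simp: enc_def G_def pos_imp_zdiv_nonneg_iff)
    qed
  qed
  have map_L: "map (enc \<circ> \<delta>) L = differences a b ix (filter (\<lambda>(u, v). E u v) (List.product vs vs)) Bs"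
    unfolding L_def differences_def map_concat map_map
    by (intro arg_cong[where f = concat] map_cong refl) (auto simp: enc_def \<delta>_def q_def)
  \<comment> \<open>The right-hand side of \<open>diffs\<close> is a filtered interval, so no
    difference repeats.\<close>
  have "distinct (merge_sort (map (enc \<circ> \<delta>) L))" unfolding map_L diffs by simp
  then have "distinct (map (enc \<circ> \<delta>) L)" using mset_eq_imp_distinct_iff mset_merge_sort by blast
  then have inj_\<delta>: "inj_on \<delta> (set L)"
    by (auto simp: distinct_map intro: inj_on_imageI2)
  have "set (merge_sort (map (enc \<circ> \<delta>) L)) = {e \<in> {0..a * b - 1}. \<not> (a' dvd e div b \<and> b' dvd e mod b)}"
    unfolding map_L diffs by auto
  also have "\<dots> = enc ` N"
    unfolding encG[symmetric] N_def using enc by auto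
  finally have "enc ` (\<delta> ` set L) = enc ` N"
    unfolding mset_eq_setD[OF mset_merge_sort] by (simp add: image_comp)
  moreover have "N \<subseteq> G" by (auto simp: N_def)
  ultimately have "\<delta> ` set L = N" by (simp add: inj_on_image_eq_iff[OF inj_enc \<delta>G])
  then have bij: "bij_betw \<delta> (set L) N" using inj_\<delta> by (simp add: bij_betw_def)
  have set_L: "set L = {(B, u, v). B \<in> set Bs \<and> u \<in> set vs \<and> v \<in> set vs \<and> E u v}"
    unfolding L_def by auto
  have "decomposable (set vs) E (range q) (graph_edges (range q) (\<lambda>x y. q (x - y) \<in> N))"
  proof (rule decomposable_difference_family[where f = "\<lambda>B v. B ! ix v" and I = "set Bs"])
    fix B u v assume *: "B \<in> set Bs" "u \<in> set vs" "v \<in> set vs" "q (B ! ix u) = q (B ! ix v)"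
    then have "inj_on (\<lambda>v. q (B ! ix v)) (set vs)" using inj by (simp add: distinct_map q_def)
    then show "u = v" using * by (simp add: inj_on_def)
  next
    show "bij_betw (\<lambda>(B, u, v). q (B ! ix u - B ! ix v))
      {(B, u, v). B \<in> set Bs \<and> u \<in> set vs \<and> v \<in> set vs \<and> E u v} N"
      using bij unfolding set_L \<delta>_def .
  qed (simp_all add: q sym)
  \<comment> \<open>As \<open>a'\<close> divides \<open>a\<close> and \<open>b'\<close> divides
    \<open>b\<close>, reduction by \<open>q\<close> does not affect these divisibilities.\<close>
  moreover have "q (x - y) \<in> N \<longleftrightarrow> \<not> (a' dvd fst x - fst y \<and> b' dvd snd x - snd y)" for x y
  proof -
    have "q (x - y) \<in> G" using range by blast
    then show ?thesis using dvd by (simp add: N_def) (simp add: q_def dvd_mod_iff)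
  qed
  ultimately show ?thesis by (simp add: range G_def)
qed

text \<open>The part size 96 = 24 * 4 comes from groups of size 24 under weight 4.\<close>

definition S_multipartite :: "nat \<Rightarrow> bool" where
  "S_multipartite t \<longleftrightarrow> S_decomposable ({..<t} \<times> {..<96::nat}) (multipartite {..<t} {..<96})"

definition S_complete :: "nat \<Rightarrow> bool" where
  "S_complete k \<longleftrightarrow> S_decomposable {..<96 * k + 1} (graph_edges {..<96 * k + 1} (\<noteq>))"

text \<open>The excluded subgroup has order \<open>r * s = 24\<close>, and its \<open>a * b\<close>
  cosets are the groups of a group divisible design with blocks of size 4. Weight 4 turns each block
  into a complete multipartite graph with four parts of size 4, covered by
  \<open>S_decomposable_K4444\<close>.\<close>

lemma S_multipartite_of_difference_family:
  fixes a b r s :: int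
  assumes pos: "0 < a" "0 < b" "0 < r" "0 < s" and rs: "r * s = 24"
    and inj: "\<forall>B\<in>set Bs. distinct (map (\<lambda>v. (fst (B ! id v) mod (a * r), snd (B ! id v) mod (b * s))) [0..<4])"
    and diffs: "merge_sort (differences (a * r) (b * s) id (filter (\<lambda>(u, v). u \<noteq> v) (List.product [0..<4] [0..<4])) Bs) =
      filter (\<lambda>d. \<not> (a dvd d div (b * s) \<and> b dvd d mod (b * s))) [0..(a * r) * (b * s) - 1]"
  shows "S_multipartite (nat (a * b))"
proof -
  define G where "G = {0..<a * r} \<times> {0..<b * s}"
  define E where "E = (\<lambda>x y :: int \<times> int. \<not> (a dvd fst x - fst y \<and> b dvd snd x - snd y))"
  define T where "T = {0..<a} \<times> {0..<b}"
  define W where "W = ({0..<r} \<times> {0..<s}) \<times> {0..<4::nat}"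
  have K4: "decomposable (set [0..<4::nat]) (\<noteq>) G (graph_edges G E)"
    unfolding G_def E_def using pos inj diffs
    by (intro decomposable_bicyclic_difference_family[where ix = id and Bs = Bs]) auto
  have E_sym: "E x y \<Longrightarrow> E y x" for x y unfolding E_def by (metis dvd_diff_commute)
  have dec: "S_decomposable (G \<times> {0..<4::nat}) (graph_edges (G \<times> {0..<4}) (\<lambda>p q. E (fst p) (fst q)))"
    using S_decomposable_K4444 by (intro decomposable_weighted[OF K4]) (auto simp: E_sym)
  \<comment> \<open>Remainders modulo \<open>a\<close> and \<open>b\<close> name the coset,
    quotients the position inside it.\<close>
  let ?g = "\<lambda>((x, y), w). ((x mod a, y mod b), ((x div a, y div b), w))"
  let ?g' = "\<lambda>((x, y), ((x', y'), w)). ((a * x' + x, b * y' + y), w)"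
  have bound: "c * z + y < c * n" if "y < c" "z < n" "0 < c" for c z y n :: int
  proof -
    have "c * (z + 1) \<le> c * n" using that by (intro mult_left_mono) auto
    then show ?thesis using that by (simp add: algebra_simps)
  qed
  have quot: "x div c < n" if "0 < c" "x < c * n" for c x n :: int
  proof -
    have "c * (x div c) \<le> x" using mult_div_mod_eq[of c x] pos_mod_sign[OF that(1), of x] by linarith
    then have "c * (x div c) < c * n" using that(2) by linarith
    then show ?thesis using that(1) by (simp add: mult_less_cancel_left_pos)
  qed
  have "bij_betw ?g (G \<times> {0..<4}) (T \<times> W)"
  proof (rule bij_betw_byWitness[where f' = ?g'])
    show "\<forall>x\<in>G \<times> {0..<4}. ?g' (?g x) = x" by auto
    show "\<forall>y\<in>T \<times> W. ?g (?g' y) = y" using pos by (auto simp: T_def W_def)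
    show "?g ` (G \<times> {0..<4}) \<subseteq> T \<times> W"
      using pos quot by (auto simp: T_def W_def G_def pos_imp_zdiv_nonneg_iff)
    show "?g' ` (T \<times> W) \<subseteq> G \<times> {0..<4}"
      using pos bound by (auto simp: T_def W_def G_def)
  qed
  then have "S_decomposable (T \<times> W) (multipartite T W)"
    by (rule decomposable_transfer[OF dec]) (auto simp: E_def mod_eq_dvd_iff)
  then show ?thesis
    unfolding S_multipartite_def
  proof (rule decomposable_multipartite_transfer)
    show "card T = card {..<nat (a * b)}" using pos by (simp add: T_def card_cartesian_product nat_mult_distrib)
    have "nat r * nat s = 24" using rs pos by (simp add: nat_mult_distrib[symmetric])
    then show "card W = card {..<96::nat}" by (simp add: W_def card_cartesian_product)
  qed (auto simp: T_def W_def)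
qed

text \<open>Here the excluded subgroup is trivial, so every nonzero difference occurs once. Base
  blocks list the images of the 16 vertices in row-major order.\<close>

lemma S_complete_of_difference_family:
  fixes a b :: int
  assumes pos: "0 < a" "0 < b" and ab: "nat (a * b) = 96 * k + 1"
    and inj: "\<forall>B\<in>set Bs. distinct (map (\<lambda>v. (fst (B ! (\<lambda>(x, y). nat (4 * x + y)) v) mod a,
      snd (B ! (\<lambda>(x, y). nat (4 * x + y)) v) mod b)) (List.product [0..3] [0..3]))"
    and diffs: "merge_sort (differences a b (\<lambda>(x, y). nat (4 * x + y))
        (filter (\<lambda>(u, v). shrikhande_E u v)
          (List.product (List.product [0..3] [0..3]) (List.product [0..3] [0..3]))) Bs) =
      filter (\<lambda>d. \<not> (a dvd d div b \<and> b dvd d mod b)) [0..a * b - 1]"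
  shows "S_complete k"
proof -
  define G where "G = {0..<a} \<times> {0..<b}"
  have V: "shrikhande_V = set (List.product [0..3] [0..3])"
    by (auto simp: shrikhande_V_def)
  have "S_decomposable G (graph_edges G (\<lambda>x y. \<not> (a dvd fst x - fst y \<and> b dvd snd x - snd y)))"
    unfolding G_def V using pos inj diffs
    by (intro decomposable_bicyclic_difference_family) (auto intro: shrikhande_E_sym)
  \<comment> \<open>Congruent representatives are equal.\<close>
  moreover have "graph_edges G (\<lambda>x y. \<not> (a dvd fst x - fst y \<and> b dvd snd x - snd y)) = graph_edges G (\<noteq>)"
  proof (rule graph_edges_cong)
    fix x y assume "x \<in> G" "y \<in> G"
    then have "fst x mod a = fst x" "fst y mod a = fst y" "snd x mod b = snd x" "snd y mod b = snd y"
      by (auto simp: G_def)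
    then show "(\<not> (a dvd fst x - fst y \<and> b dvd snd x - snd y)) \<longleftrightarrow> x \<noteq> y"
      unfolding mod_eq_dvd_iff[symmetric] by (auto simp: prod_eq_iff)
  qed
  ultimately have "S_decomposable G (graph_edges G (\<noteq>))" by simp
  then show ?thesis
    unfolding S_complete_def
  proof (rule decomposable_complete_transfer)
    show "card G = card {..<96 * k + 1}"
      using ab pos by (simp add: G_def card_cartesian_product nat_mult_distrib)
  qed (auto simp: G_def)
qed

section \<open>Necessity\<close>

text \<open>Each edge is oriented towards the larger row-major number, so it is listed once and
  counts can be evaluated.\<close>

definition shrikhande_edge_list :: "((int \<times> int) \<times> (int \<times> int)) list" where
  "shrikhande_edge_list = filter (\<lambda>(u, v). shrikhande_E u v \<and> 4 * fst u + snd u < 4 * fst v + snd v)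
     (List.product (List.product [0..3] [0..3]) (List.product [0..3] [0..3]))"

lemma graph_edges_shrikhande:
  "graph_edges shrikhande_V shrikhande_E = (\<lambda>(u, v). {u, v}) ` set shrikhande_edge_list"
proof
  have ne: "4 * fst u + snd u \<noteq> 4 * fst v + snd v" if "shrikhande_E u v" "u \<in> shrikhande_V" "v \<in> shrikhande_V" for u v
  proof -
    have "u \<noteq> v" using that(1) by (auto simp: shrikhande_E_def)
    then show ?thesis using that(2,3) by (auto simp: shrikhande_V_def prod_eq_iff; presburger)
  qed
  have "{u, v} \<in> (\<lambda>(u, v). {u, v}) ` set shrikhande_edge_list"
    if *: "shrikhande_E u v" "u \<in> shrikhande_V" "v \<in> shrikhande_V" for u v
  proof (cases "4 * fst u + snd u < 4 * fst v + snd v")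
    case True
    then have "(u, v) \<in> set shrikhande_edge_list"
      using * by (auto simp: shrikhande_edge_list_def shrikhande_V_def)
    then show ?thesis by force
  next
    case False
    then have "4 * fst v + snd v < 4 * fst u + snd u" using ne[OF *] by simp
    then have "(v, u) \<in> set shrikhande_edge_list"
      using * shrikhande_E_sym[OF *(1)] by (auto simp: shrikhande_edge_list_def shrikhande_V_def)
    then show ?thesis by (intro image_eqI[of _ _ "(v, u)"]) auto
  qed
  then show "graph_edges shrikhande_V shrikhande_E \<subseteq> (\<lambda>(u, v). {u, v}) ` set shrikhande_edge_list"
    unfolding graph_edges_def by blast
  show "(\<lambda>(u, v). {u, v}) ` set shrikhande_edge_list \<subseteq> graph_edges shrikhande_V shrikhande_E"
    by (auto simp: shrikhande_edge_list_def shrikhande_V_def intro!: graph_edgesI)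
qed

lemma inj_on_shrikhande_edge_list: "inj_on (\<lambda>(u, v). {u, v}) (set shrikhande_edge_list)"
  by (auto simp: inj_on_def shrikhande_edge_list_def doubleton_eq_iff)

lemma distinct_shrikhande_edge_list: "distinct shrikhande_edge_list"
  by (simp add: shrikhande_edge_list_def distinct_product)

lemma card_shrikhande_edges: "card (graph_edges shrikhande_V shrikhande_E) = 48"
proof -
  have "length shrikhande_edge_list = 48" by code_simp
  then show ?thesis
    unfolding graph_edges_shrikhande
    by (simp add: card_image[OF inj_on_shrikhande_edge_list] distinct_card[OF distinct_shrikhande_edge_list])
qed

lemma shrikhande_degree:
  assumes "v \<in> shrikhande_V"
  shows "card {e \<in> graph_edges shrikhande_V shrikhande_E. v \<in> e} = 6"
proof -
  let ?L = "\<lambda>v. filter (\<lambda>(x, y). v = x \<or> v = y) shrikhande_edge_list"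
  have "{e \<in> graph_edges shrikhande_V shrikhande_E. v \<in> e} = (\<lambda>(u, v). {u, v}) ` set (?L v)"
    unfolding graph_edges_shrikhande by auto
  moreover have "inj_on (\<lambda>(u, v). {u, v}) (set (?L v))"
    by (rule inj_on_subset[OF inj_on_shrikhande_edge_list]) auto
  moreover have "distinct (?L v)" using distinct_shrikhande_edge_list by simp
  moreover have "length (?L v) = 6"
  proof -
    have "\<forall>v\<in>set (List.product [0..3] [0..3]). length (?L v) = 6" by code_simp
    then show ?thesis using assms by (auto simp: shrikhande_V_def)
  qed
  ultimately show ?thesis by (simp add: card_image distinct_card del: set_filter)
qed

lemma has_design_shrikhande_imp_mod:
  assumes "1 \<le> n" "has_design shrikhande_V shrikhande_E n"
  shows "n mod 96 = 1"
proof -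
  obtain D where copies: "\<And>B. B \<in> D \<Longrightarrow> is_copy_edges shrikhande_V shrikhande_E {0..<n} B"
      and disj: "\<And>B B'. B \<in> D \<Longrightarrow> B' \<in> D \<Longrightarrow> B \<noteq> B' \<Longrightarrow> B \<inter> B' = {}"
      and cover: "\<Union>D = graph_edges {0..<n} (\<noteq>)"
    using assms(2) unfolding has_design_def is_decomposition_def by metis
  have finV: "finite shrikhande_V" by (simp add: shrikhande_V_def)
  have finE: "finite (graph_edges {0..<n} (\<noteq>))"
    by (rule finite_subset[OF graph_edges_subset_Pow]) simp
  have finD: "finite D" using cover finE by (metis finite_UnionD)
  have finB: "finite B" if "B \<in> D" for B using that cover finE by (metis Union_upper finite_subset)
  have card_B: "card B = 48" if B: "B \<in> D" for B
  proof -
    obtain f where f: "inj_on f shrikhande_V"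
        "B = (\<lambda>e. f ` e) ` graph_edges shrikhande_V shrikhande_E"
      using copies[OF B] unfolding is_copy_edges_def by blast
    have "inj_on ((`) f) (graph_edges shrikhande_V shrikhande_E)"
      by (rule inj_on_subset[OF inj_on_image_Pow[OF f(1)] graph_edges_subset_Pow])
    then show ?thesis unfolding f(2) by (simp add: card_image card_shrikhande_edges)
  qed
  have edges: "graph_edges {0..<n} (\<noteq>) = {e. e \<subseteq> {0..<n} \<and> card e = 2}"
  proof (intro set_eqI iffI)
    fix e assume "e \<in> graph_edges {0..<n} (\<noteq>)"
    then obtain u v where "e = {u, v}" "u \<in> {0..<n}" "v \<in> {0..<n}" "u \<noteq> v"
      unfolding graph_edges_def by blast
    then show "e \<in> {e. e \<subseteq> {0..<n} \<and> card e = 2}" by simp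
  next
    fix e assume e: "e \<in> {e. e \<subseteq> {0..<n} \<and> card e = 2}"
    then have "\<exists>u v. e = {u, v} \<and> u \<noteq> v" by (simp add: card_2_iff)
    then obtain u v where "e = {u, v}" "u \<noteq> v" by blast
    then show "e \<in> graph_edges {0..<n} (\<noteq>)" using e by (simp add: graph_edgesI)
  qed
  \<comment> \<open>Counting edges by classes gives
    \<open>n * (n - 1) = 96 * card D\<close>.\<close>
  have "n choose 2 = card (\<Union>D)" unfolding cover edges using n_subsets[of "{0..<n}" 2] by simp
  also have "\<dots> = (\<Sum>B\<in>D. card B)" using disj finB by (intro card_Union_disjoint) (auto simp: pairwise_def disjnt_def)
  also have "\<dots> = 48 * card D" using card_B by simp
  finally have "n * (n - 1) div 2 = 48 * card D" by (simp add: choose_two)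
  moreover have "even (n * (n - 1))" by (cases "even n") auto
  then have "2 * (n * (n - 1) div 2) = n * (n - 1)" by (rule dvd_mult_div_cancel)
  ultimately have "n * (n - 1) = 96 * card D" by linarith
  then have total: "96 dvd n * (n - 1)" by simp
  \<comment> \<open>A copy of the 6-regular graph has degree 6 at vertex 0 if it passes through 0;
    otherwise no edge of it contains 0.\<close>
  have deg: "card {e \<in> B. 0 \<in> e} \<in> {0, 6}" if B: "B \<in> D" for B
  proof -
    obtain f where f: "inj_on f shrikhande_V"
        "B = (\<lambda>e. f ` e) ` graph_edges shrikhande_V shrikhande_E"
      using copies[OF B] unfolding is_copy_edges_def by blast
    show ?thesis
    proof (cases "\<exists>v\<in>shrikhande_V. f v = 0")
      case True
      then obtain v where v: "v \<in> shrikhande_V" "f v = 0" by blast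
      have "0 \<in> f ` e \<longleftrightarrow> v \<in> e" if "e \<in> graph_edges shrikhande_V shrikhande_E" for e
        using inj_on_image_mem_iff[OF f(1) v(1), of e] that graph_edges_subset_Pow v(2) by (metis Pow_iff subsetD)
      then have "{e \<in> B. 0 \<in> e} = (`) f ` {e \<in> graph_edges shrikhande_V shrikhande_E. v \<in> e}"
        unfolding f(2) by blast
      moreover have "inj_on ((`) f) {e \<in> graph_edges shrikhande_V shrikhande_E. v \<in> e}"
        by (rule inj_on_subset[OF inj_on_image_Pow[OF f(1)]]) (use graph_edges_subset_Pow in blast)
      ultimately show ?thesis using shrikhande_degree[OF v(1)] by (simp add: card_image)
    next
      case False
      then have "0 \<notin> e" if "e \<in> B" for e
        using that graph_edges_subset_Pow[of shrikhande_V shrikhande_E] unfolding f(2) by fastforce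
      then have "{e \<in> B. 0 \<in> e} = {}" by blast
      then show ?thesis by (simp only: card.empty insert_iff simp_thms)
    qed
  qed
  have "{e \<in> graph_edges {0..<n} (\<noteq>). 0 \<in> e} = (\<lambda>x. {0, x}) ` {1..<n}"
  proof (intro set_eqI iffI)
    fix e assume "e \<in> {e \<in> graph_edges {0..<n} (\<noteq>). 0 \<in> e}"
    then obtain u v where "e = {u, v}" "u < n" "v < n" "u \<noteq> v" "0 = u \<or> 0 = v"
      unfolding graph_edges_def by auto
    then show "e \<in> (\<lambda>x. {0, x}) ` {1..<n}" by (auto simp: insert_commute)
  next
    fix e assume "e \<in> (\<lambda>x. {0, x}) ` {1..<n}"
    then show "e \<in> {e \<in> graph_edges {0..<n} (\<noteq>). 0 \<in> e}" by (auto intro!: graph_edgesI)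
  qed
  moreover have "inj_on (\<lambda>x. {0, x}) {1..<n}" by (auto simp: inj_on_def doubleton_eq_iff)
  ultimately have "n - 1 = card {e \<in> graph_edges {0..<n} (\<noteq>). 0 \<in> e}" by (simp add: card_image)
  also have "{e \<in> graph_edges {0..<n} (\<noteq>). 0 \<in> e} = (\<Union>B\<in>D. {e \<in> B. 0 \<in> e})"
    unfolding cover[symmetric] by blast
  also have "card \<dots> = (\<Sum>B\<in>D. card {e \<in> B. 0 \<in> e})"
  proof (rule card_UN_disjoint)
    show "\<forall>B\<in>D. finite {e \<in> B. 0 \<in> e}" using finB by simp
    show "\<forall>B\<in>D. \<forall>B'\<in>D. B \<noteq> B' \<longrightarrow> {e \<in> B. 0 \<in> e} \<inter> {e \<in> B'. 0 \<in> e} = {}"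
      using disj by fast
  qed (rule finD)
  finally have deg_sum: "n - 1 = (\<Sum>B\<in>D. card {e \<in> B. 0 \<in> e})" .
  have "6 dvd card {e \<in> B. 0 \<in> e}" if "B \<in> D" for B using deg[OF that] by auto
  then have "6 dvd n - 1" unfolding deg_sum by (rule dvd_sum)
  then obtain k where "n - 1 = 6 * k" by (rule dvdE)
  then have k: "n = 6 * k + 1" using assms(1) by simp
  have "n * (n - 1) = 6 * (k * (6 * k + 1))" unfolding k by simp
  then have "6 * 16 dvd 6 * (k * (6 * k + 1))" using total by simp
  then have "16 dvd k * (6 * k + 1)" by (rule nat_mult_dvd_cancel1[THEN iffD1, rotated]) simp
  \<comment> \<open>The factor \<open>6 * k + 1\<close> is odd, so all of 16 divides
    \<open>k\<close>.\<close>
  moreover have "coprime (2 ^ 4) (6 * k + 1)" unfolding coprime_power_left_iff by simp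
  then have "coprime 16 (6 * k + 1)" by simp
  ultimately have "16 dvd k" using coprime_dvd_mult_left_iff by blast
  then show ?thesis using k by auto
qed

lemma has_design_of_S_complete:
  assumes "S_complete k"
  shows "has_design shrikhande_V shrikhande_E (96 * k + 1)"
proof -
  obtain D where D: "\<forall>B\<in>D. is_copy_edges shrikhande_V shrikhande_E {..<96 * k + 1} B"
      "\<forall>B\<in>D. \<forall>B'\<in>D. B \<noteq> B' \<longrightarrow> B \<inter> B' = {}" "\<Union>D = graph_edges {..<96 * k + 1} (\<noteq>)"
    using assms unfolding S_complete_def decomposable_def by (elim exE conjE) (rule that)
  \<comment> \<open>\<open>is_decomposition\<close> demands nonempty classes; a copy has edges
    because the Shrikhande graph does.\<close>
  have "graph_edges shrikhande_V shrikhande_E \<noteq> {}" using card_shrikhande_edges by force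
  then have "B \<noteq> {}" if "B \<in> D" for B
    using bspec[OF D(1) that] unfolding is_copy_edges_def by (metis image_is_empty)
  then show ?thesis
    unfolding has_design_def is_decomposition_def
    by (intro exI[of _ D]) (use D in \<open>simp add: lessThan_atLeast0\<close>)
qed

section \<open>Recursive constructions\<close>

text \<open>The blocks are partial transversals of the classes of \<open>cl\<close>. Every point
  gets weight 96 and one point \<open>None\<close> is added: blocks become complete multipartite
  graphs, and each class joined with \<open>None\<close> carries a design.\<close>

lemma S_complete_of_GDD:
  fixes cl :: "'a \<Rightarrow> 'c" and B :: "'i \<Rightarrow> 'a set"
  assumes fin: "finite X"
    and blocks: "\<And>i. i \<in> I \<Longrightarrow> B i \<subseteq> X \<and> inj_on cl (B i) \<and> S_multipartite (card (B i))"
    and ex: "\<And>x y. x \<in> X \<Longrightarrow> y \<in> X \<Longrightarrow> cl x \<noteq> cl y \<Longrightarrow> \<exists>i\<in>I. x \<in> B i \<and> y \<in> B i"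
    and uniq: "\<And>x y i j. cl x \<noteq> cl y \<Longrightarrow> i \<in> I \<Longrightarrow> j \<in> I \<Longrightarrow> x \<in> B i \<Longrightarrow> y \<in> B i \<Longrightarrow>
      x \<in> B j \<Longrightarrow> y \<in> B j \<Longrightarrow> i = j"
    and groups: "\<And>c. c \<in> cl ` X \<Longrightarrow> S_complete (card {x \<in> X. cl x = c})"
  shows "S_complete (card X)"
proof -
  define W where "W = {..<96::nat}"
  define Y where "Y = insert None (Some ` (X \<times> W))"
  define G where "G c = insert None (Some ` ({x \<in> X. cl x = c} \<times> W))" for c
  \<comment> \<open>\<open>Inl c\<close> collects the pairs inside the extended group of class
    \<open>c\<close>, \<open>Inr i\<close> those over two points of block \<open>i\<close>.\<close>
  define R :: "'c + 'i \<Rightarrow> ('a \<times> nat) option \<Rightarrow> ('a \<times> nat) option \<Rightarrow> bool" where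
    "R = (\<lambda>k p q. case k of Inl c \<Rightarrow> p \<noteq> q \<and> p \<in> G c \<and> q \<in> G c
       | Inr i \<Rightarrow> p \<in> Some ` (B i \<times> W) \<and> q \<in> Some ` (B i \<times> W) \<and> fst (the p) \<noteq> fst (the q))"
  have card_Some: "finite (insert None (Some ` (Z \<times> W))) \<and> card (insert None (Some ` (Z \<times> W))) = 96 * card Z + 1"
    if "finite Z" for Z :: "'a set"
  proof -
    have "card (Some ` (Z \<times> W)) = card Z * 96"
      by (simp add: card_image card_cartesian_product W_def)
    then show ?thesis using that by (simp add: W_def)
  qed
  have "S_decomposable Y (graph_edges Y (\<noteq>))"
  proof (rule decomposable_relation_UN[where I = "Inl ` cl ` X \<union> Inr ` I" and R = R])
    fix k assume "k \<in> Inl ` cl ` X \<union> Inr ` I"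
    then consider (group) c where "k = Inl c" "c \<in> cl ` X" | (block) i where "k = Inr i" "i \<in> I" by blast
    then show "S_decomposable Y (graph_edges Y (R k))"
    proof cases
      case group
      have GY: "G c \<subseteq> Y" by (auto simp: G_def Y_def)
      have "graph_edges Y (R k) = graph_edges (G c) (R k)"
        using GY by (intro graph_edges_restrict) (auto simp: R_def group(1))
      also have "\<dots> = graph_edges (G c) (\<noteq>)"
        by (intro graph_edges_cong) (auto simp: R_def group(1))
      finally have eq: "graph_edges Y (R k) = graph_edges (G c) (\<noteq>)" .
      have "finite {x \<in> X. cl x = c}" using fin by simp
      note card_G = card_Some[OF this, folded G_def]
      show ?thesis
        unfolding eq using card_G GY
        by (intro decomposable_complete_transfer[OF groups[OF group(2), unfolded S_complete_def]]) auto
    next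
      case block
      have fB: "finite (B i)" using blocks[OF block(2)] fin finite_subset by blast
      have BY: "Some ` (B i \<times> W) \<subseteq> Y" using blocks[OF block(2)] by (auto simp: Y_def)
      have "graph_edges Y (R k) = graph_edges (Some ` (B i \<times> W)) (R k)"
        using BY by (intro graph_edges_restrict) (auto simp: R_def block(1))
      also have "\<dots> = graph_edges (Some ` (B i \<times> W)) (\<lambda>p q. fst (the p) \<noteq> fst (the q))"
        by (intro graph_edges_cong) (auto simp: R_def block(1))
      finally have eq: "graph_edges Y (R k) = graph_edges (Some ` (B i \<times> W)) (\<lambda>p q. fst (the p) \<noteq> fst (the q))" .
      have "S_decomposable (B i \<times> W) (multipartite (B i) W)"
      proof (rule decomposable_multipartite_transfer)
        show "S_decomposable ({..<card (B i)} \<times> {..<96::nat}) (multipartite {..<card (B i)} {..<96})"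
          using blocks[OF block(2)] unfolding S_multipartite_def by blast
      qed (simp_all add: fB W_def)
      then show ?thesis
        unfolding eq using BY by (intro decomposable_transfer[of _ _ "B i \<times> W" _ Some]) (auto simp: bij_betw_def)
    qed
  next
    fix p q assume pq: "p \<in> Y" "q \<in> Y"
    show "p \<noteq> q \<longleftrightarrow> (\<exists>k\<in>Inl ` cl ` X \<union> Inr ` I. R k p q)"
    proof
      assume ne: "p \<noteq> q"
      show "\<exists>k\<in>Inl ` cl ` X \<union> Inr ` I. R k p q"
      proof (cases "\<exists>c\<in>cl ` X. p \<in> G c \<and> q \<in> G c")
        case True
        then obtain c where "c \<in> cl ` X" "R (Inl c) p q" using ne by (auto simp: R_def)
        then show ?thesis by blast
      next
        case False
        \<comment> \<open>\<open>None\<close> lies in every extended group, so two distinct points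
          without a common group both come from \<open>X \<times> W\<close>.\<close>
        then obtain x s y t where xy: "p = Some (x, s)" "q = Some (y, t)" "x \<in> X" "y \<in> X" "s \<in> W" "t \<in> W"
          using pq ne by (auto simp: Y_def G_def)
        then have "cl x \<noteq> cl y" using False by (auto simp: G_def)
        then obtain i where "i \<in> I" "x \<in> B i" "y \<in> B i" using ex xy by blast
        then have "R (Inr i) p q" using xy \<open>cl x \<noteq> cl y\<close> by (auto simp: R_def)
        then show ?thesis using \<open>i \<in> I\<close> by blast
      qed
    qed (auto simp: R_def)
  next
    fix k l p q assume kl: "k \<in> Inl ` cl ` X \<union> Inr ` I" "l \<in> Inl ` cl ` X \<union> Inr ` I"
      and R: "R k p q" "R l p q"
    have inj: "cl x \<noteq> cl y" if "i \<in> I" "x \<in> B i" "y \<in> B i" "x \<noteq> y" for i x y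
      using blocks that inj_onD by metis
    \<comment> \<open>One of two distinct points differs from \<open>None\<close> and determines the
      class.\<close>
    have GG: "c = d" if "p \<noteq> q" "p \<in> G c" "q \<in> G c" "p \<in> G d" "q \<in> G d" for c d
      using that by (auto simp: G_def)
    have GB: False if "i \<in> I" "R (Inr i) p q" "R (Inl c) p q" for i c
      using that inj[OF that(1)] by (auto simp: R_def G_def)
    show "k = l"
    proof (cases k; cases l)
      fix c d assume *: "k = Inl c" "l = Inl d"
      then show "k = l" using R GG[of c d] by (simp add: R_def)
    next
      fix i j assume *: "k = Inr i" "l = Inr j"
      then have ij: "i \<in> I" "j \<in> I" using kl by auto
      obtain x y where "x \<in> B i" "y \<in> B i" "x \<in> B j" "y \<in> B j" "x \<noteq> y"
        using R * by (auto simp: R_def)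
      then have "i = j" using inj[OF ij(1)] uniq[of x y i j] ij by simp
      then show "k = l" using * by simp
    next
      fix c i assume "k = Inl c" "l = Inr i"
      then show "k = l" using GB[of i c] kl R by auto
    next
      fix c i assume "k = Inr i" "l = Inl c"
      then show "k = l" using GB[of i c] kl R by auto
    qed
  qed (auto simp: R_def split: sum.splits)
  then show ?thesis
    unfolding S_complete_def
    by (rule decomposable_complete_transfer) (use card_Some[OF fin] in \<open>simp_all add: Y_def\<close>)
qed

lemma S_complete_0: "S_complete 0"
proof -
  have "graph_edges {..<96 * 0 + 1 :: nat} (\<noteq>) = {}" by (auto simp: graph_edges_def)
  then show ?thesis unfolding S_complete_def by (metis decomposable_empty)
qed

text \<open>A single block on \<open>t\<close> points with singleton groups is used as the design:
  the \<open>t\<close> parts, each joined with the common point, carry designs of order 97.\<close>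

lemma S_complete_of_multipartite:
  assumes "S_multipartite t" "S_complete 1"
  shows "S_complete t"
proof -
  have "S_complete (card {..<t})"
  proof (rule S_complete_of_GDD[where cl = id and I = "{()}" and B = "\<lambda>_. {..<t}"])
    fix c assume "c \<in> id ` {..<t}"
    then have "{x \<in> {..<t}. id x = c} = {c}" by auto
    then show "S_complete (card {x \<in> {..<t}. id x = c})" using assms(2) by simp
  qed (use assms(1) in simp_all)
  then show ?thesis by simp
qed

text \<open>Block \<open>(a, b)\<close> of the transversal design meets column \<open>j < c\<close>
  in \<open>a + j * b\<close> and column \<open>c\<close>, the one at infinity, in \<open>b\<close>.
  Column \<open>j\<close> is cut to its first \<open>s j\<close> points; the four full columns keep
  block sizes between 4 and \<open>c + 1\<close>.\<close>

lemma S_complete_of_truncated_TD: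
  fixes m c :: nat and s :: "nat \<Rightarrow> nat"
  assumes m: "0 < m"
    and cop: "\<And>d. 0 < d \<Longrightarrow> d < c \<Longrightarrow> coprime d m"
    and c: "3 \<le> c" and full: "\<And>j. j < 4 \<Longrightarrow> s j = m" and s: "\<And>j. j \<le> c \<Longrightarrow> s j \<le> m"
    and groups: "\<And>j. j \<le> c \<Longrightarrow> S_complete (s j)"
    and blocks: "\<And>t. 4 \<le> t \<Longrightarrow> t \<le> c + 1 \<Longrightarrow> S_multipartite t"
  shows "S_complete (\<Sum>j\<le>c. s j)"
proof -
  define X where "X = (SIGMA j:{..c}. {..<s j})"
  define r where "r = (\<lambda>j (a, b). if j = c then b else (a + j * b) mod m)"
  define I where "I = {..<m} \<times> {..<m}"
  define B where "B = (\<lambda>p. {(j, x) \<in> X. x = r j p})"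
  have r_inj: "p = p'" if "i < j" "j \<le> c" "p \<in> I" "p' \<in> I" "r i p = r i p'" "r j p = r j p'" for i j p p'
  proof -
    obtain a b a' b' where p: "p = (a, b)" "p' = (a', b')" "a < m" "b < m" "a' < m" "b' < m"
      using \<open>p \<in> I\<close> \<open>p' \<in> I\<close> unfolding I_def by auto
    have i: "(a + i * b) mod m = (a' + i * b') mod m" using that p by (auto simp: r_def)
    have b: "b = b'"
    proof (cases "j = c")
      case True then show ?thesis using that p by (auto simp: r_def)
    next
      case False
      then have j: "(a + j * b) mod m = (a' + j * b') mod m" using that p by (auto simp: r_def)
      have "int m dvd (int a + int i * int b) - (int a' + int i * int b')"
        using i by (metis mod_eq_dvd_iff of_nat_add of_nat_mult zmod_int)
      moreover have "int m dvd (int a + int j * int b) - (int a' + int j * int b')"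
        using j by (metis mod_eq_dvd_iff of_nat_add of_nat_mult zmod_int)
      \<comment> \<open>Subtracting the congruences eliminates \<open>a\<close>; the factor
        \<open>j - i\<close> is invertible modulo \<open>m\<close>.\<close>
      ultimately have "int m dvd ((int a + int j * int b) - (int a' + int j * int b')) -
          ((int a + int i * int b) - (int a' + int i * int b'))" by (rule dvd_diff[rotated])
      also have "\<dots> = int (j - i) * (int b - int b')"
        using \<open>i < j\<close> by (simp add: of_nat_diff algebra_simps)
      finally have "int m dvd int (j - i) * (int b - int b')" .
      moreover have "coprime (int m) (int (j - i))"
        unfolding coprime_int_iff using cop[of "j - i"] that False by (simp add: coprime_commute)
      ultimately have "int m dvd int b - int b'" by (simp add: coprime_dvd_mult_right_iff)
      then have "int b mod int m = int b' mod int m" by (simp add: mod_eq_dvd_iff)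
      then show ?thesis using p by simp
    qed
    have "int m dvd (int a + int i * int b) - (int a' + int i * int b')"
      using i by (metis mod_eq_dvd_iff of_nat_add of_nat_mult zmod_int)
    then have "int a mod int m = int a' mod int m" using b by (simp add: mod_eq_dvd_iff)
    then show ?thesis using p b by simp
  qed
  have r_less: "r j p < m" if "p \<in> I" for j p using that m by (auto simp: r_def I_def)
  have r_surj: "\<exists>p\<in>I. r i p = x \<and> r j p = y" if "i < j" "j \<le> c" "x < m" "y < m" for i j x y
  proof -
    \<comment> \<open>Both the blocks and the pairs of entries are counted by \<open>m * m\<close>,
      so injectivity gives surjectivity.\<close>
    have "(\<lambda>p. (r i p, r j p)) ` I = I"
    proof (rule endo_inj_surj)
      show "finite I" by (simp add: I_def)
      show "(\<lambda>p. (r i p, r j p)) ` I \<subseteq> I" using r_less by (auto simp: I_def)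
      show "inj_on (\<lambda>p. (r i p, r j p)) I" using r_inj that by (intro inj_onI) blast
    qed
    moreover have "(x, y) \<in> I" using that by (simp add: I_def)
    ultimately have "(x, y) \<in> (\<lambda>p. (r i p, r j p)) ` I" by simp
    then show ?thesis by auto
  qed
  have fin: "finite X" by (simp add: X_def)
  have "S_complete (card X)"
  proof (rule S_complete_of_GDD[where cl = fst and I = I and B = B])
    fix p assume p: "p \<in> I"
    have inj: "inj_on fst (B p)" by (auto simp: inj_on_def B_def)
    have "fst ` B p \<subseteq> {..c}" by (auto simp: B_def X_def)
    then have "card (B p) \<le> c + 1" using card_mono[of "{..c}" "fst ` B p"] card_image[OF inj] by simp
    moreover have "{..<4} \<subseteq> fst ` B p"
    proof
      fix j :: nat assume "j \<in> {..<4}"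
      then have "(j, r j p) \<in> B p" using r_less[OF p] full c by (auto simp: B_def X_def)
      then show "j \<in> fst ` B p" by force
    qed
    then have "4 \<le> card (B p)"
      using card_mono[of "fst ` B p" "{..<4}"] card_image[OF inj] finite_subset[OF _ fin, of "B p"]
      by (auto simp: B_def)
    ultimately show "B p \<subseteq> X \<and> inj_on fst (B p) \<and> S_multipartite (card (B p))"
      using blocks inj by (auto simp: B_def)
  next
    fix x y assume xy: "x \<in> X" "y \<in> X" "fst x \<noteq> fst y"
    then have lt: "fst x \<le> c" "fst y \<le> c" "snd x < m" "snd y < m"
      using s by (auto simp: X_def intro: less_le_trans)
    have "\<exists>p\<in>I. r (fst x) p = snd x \<and> r (fst y) p = snd y"
    proof (cases "fst x < fst y")
      case True then show ?thesis using r_surj lt by blast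
    next
      case False
      then have "fst y < fst x" using xy by simp
      then show ?thesis using r_surj[of "fst y" "fst x"] lt by blast
    qed
    then show "\<exists>p\<in>I. x \<in> B p \<and> y \<in> B p" using xy by (force simp: B_def)
  next
    fix x y p p' assume "fst x \<noteq> fst y" "p \<in> I" "p' \<in> I" "x \<in> B p" "y \<in> B p" "x \<in> B p'" "y \<in> B p'"
    moreover from this have "r (fst x) p = r (fst x) p'" "r (fst y) p = r (fst y) p'" "fst x \<le> c" "fst y \<le> c"
      by (auto simp: B_def X_def)
    ultimately show "p = p'" using r_inj by (metis linorder_neqE_nat)
  next
    fix j assume "j \<in> fst ` X"
    then have j: "j \<le> c" by (auto simp: X_def)
    then have "{x \<in> X. fst x = j} = {j} \<times> {..<s j}" by (auto simp: X_def)
    then show "S_complete (card {x \<in> X. fst x = j})" using groups[OF j] by (simp add: card_cartesian_product)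
  qed (rule fin)
  moreover have "card X = (\<Sum>j\<le>c. s j)" by (simp add: X_def)
  ultimately show ?thesis by simp
qed

section \<open>Explicit difference families\<close>

text \<open>These relative difference families were found by computer search.\<close>

lemma S_multipartite_4: "S_multipartite 4"
proof -
  \<comment> \<open>The cyclic group of order 96 admits no such family: a block would meet all
    residues modulo 4, so its four differences congruent to 1 would sum to 0, whereas all elements
    congruent to 1 sum to 72.\<close>
  have "S_multipartite (nat (2 * 2))"
    by (rule S_multipartite_of_difference_family[where r = 2 and s = 12 and Bs =
      "[[(0, 0), (1, 14), (2, 17), (1, 9)], [(0, 0), (3, 6), (1, 21), (0, 23)],
       [(0, 0), (0, 11), (3, 12), (3, 9)], [(0, 0), (3, 11), (2, 5), (1, 10)],
       [(0, 0), (3, 19), (3, 4), (2, 3)], [(0, 0), (2, 11), (1, 11), (1, 4)]]"]) code_simp+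
  then show ?thesis by simp
qed

lemma S_multipartite_5: "S_multipartite 5"
proof -
  \<comment> \<open>The first factor is trivial: the group is cyclic of order \<open>24 * t\<close>
    with the multiples of \<open>t\<close> as subgroup. The same holds for the later values of
    \<open>t\<close> except 12 and 16.\<close>
  have "S_multipartite (nat (1 * 5))"
    by (rule S_multipartite_of_difference_family[where r = 1 and s = 24 and Bs =
      "map (map (Pair 0)) [[0, 32, 9, 3], [0, 112, 79, 51], [0, 102, 104, 83], [0, 64, 53, 1],
       [0, 82, 48, 36], [0, 94, 98, 17], [0, 14, 76, 27], [0, 113, 66, 24]]"]) code_simp+
  then show ?thesis by simp
qed

lemma S_multipartite_6: "S_multipartite 6"
proof -
  have "S_multipartite (nat (1 * 6))"
    by (rule S_multipartite_of_difference_family[where r = 1 and s = 24 and Bs =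
      "map (map (Pair 0)) [[0, 43, 15, 2], [0, 19, 93, 64], [0, 104, 58, 21], [0, 76, 59, 32],
       [0, 63, 49, 11], [0, 111, 137, 55], [0, 16, 135, 113], [0, 121, 124, 71],
       [0, 140, 139, 105], [0, 67, 75, 10]]"]) code_simp+
  then show ?thesis by simp
qed

lemma S_multipartite_7: "S_multipartite 7"
proof -
  have "S_multipartite (nat (1 * 7))"
    by (rule S_multipartite_of_difference_family[where r = 1 and s = 24 and Bs =
      "map (map (Pair 0)) [[0, 43, 46, 20], [0, 79, 45, 32], [0, 128, 95, 66], [0, 162, 88, 72],
       [0, 93, 129, 118], [0, 137, 55, 17], [0, 103, 163, 59], [0, 158, 150, 149],
       [0, 117, 144, 76], [0, 99, 97, 12], [0, 15, 67, 37], [0, 61, 114, 4]]"]) code_simp+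
  then show ?thesis by simp
qed

lemma S_multipartite_8: "S_multipartite 8"
proof -
  have "S_multipartite (nat (1 * 8))"
    by (rule S_multipartite_of_difference_family[where r = 1 and s = 24 and Bs =
      "map (map (Pair 0)) [[0, 13, 51, 39], [0, 124, 113, 58], [0, 85, 28, 18], [0, 53, 4, 3],
       [0, 73, 167, 75], [0, 105, 71, 42], [0, 31, 133, 17], [0, 33, 78, 69], [0, 99, 84, 62],
       [0, 172, 118, 111], [0, 149, 46, 27], [0, 101, 95, 60], [0, 5, 145, 115],
       [0, 106, 127, 83]]"]) code_simp+
  then show ?thesis by simp
qed

lemma S_multipartite_9: "S_multipartite 9"
proof -
  have "S_multipartite (nat (1 * 9))"
    by (rule S_multipartite_of_difference_family[where r = 1 and s = 24 and Bs =
      "map (map (Pair 0)) [[0, 205, 185, 12], [0, 203, 82, 57], [0, 67, 26, 105],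
       [0, 125, 186, 167], [0, 37, 138, 103], [0, 58, 133, 127], [0, 50, 29, 143],
       [0, 168, 214, 62], [0, 157, 65, 60], [0, 130, 145, 131], [0, 194, 17, 139],
       [0, 109, 165, 112], [0, 44, 142, 10], [0, 176, 209, 129], [0, 28, 128, 32],
       [0, 76, 68, 52]]"]) code_simp+
  then show ?thesis by simp
qed

lemma S_multipartite_10: "S_multipartite 10"
proof -
  have "S_multipartite (nat (1 * 10))"
    by (rule S_multipartite_of_difference_family[where r = 1 and s = 24 and Bs =
      "map (map (Pair 0)) [[0, 14, 152, 69], [0, 118, 184, 153], [0, 206, 8, 141],
       [0, 22, 136, 177], [0, 167, 176, 139], [0, 19, 112, 23], [0, 143, 224, 211],
       [0, 91, 208, 47], [0, 95, 169, 116], [0, 235, 173, 52], [0, 215, 1, 164],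
       [0, 115, 197, 148], [0, 132, 96, 84], [0, 86, 213, 11], [0, 142, 201, 7],
       [0, 134, 237, 179], [0, 238, 129, 223], [0, 216, 222, 54]]"]) code_simp+
  then show ?thesis by simp
qed

lemma S_multipartite_11: "S_multipartite 11"
proof -
  have "S_multipartite (nat (1 * 11))"
    by (rule S_multipartite_of_difference_family[where r = 1 and s = 24 and Bs =
      "map (map (Pair 0)) [[0, 145, 124, 15], [0, 193, 196, 111], [0, 73, 148, 135],
       [0, 241, 4, 207], [0, 217, 100, 159], [0, 160, 136, 90], [0, 40, 232, 138],
       [0, 208, 256, 18], [0, 184, 64, 186], [0, 112, 16, 162], [0, 149, 158, 65],
       [0, 29, 254, 41], [0, 197, 14, 233], [0, 173, 86, 17], [0, 101, 38, 161],
       [0, 97, 234, 5], [0, 49, 42, 125], [0, 169, 258, 221], [0, 1, 114, 245],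
       [0, 25, 210, 53]]"]) code_simp+
  then show ?thesis by simp
qed

lemma S_multipartite_12: "S_multipartite 12"
proof -
  \<comment> \<open>The group is the product of cyclic groups of orders 12 and 24; the second
    coordinate modulo 12 names the coset.\<close>
  have "S_multipartite (nat (1 * 12))"
    by (rule S_multipartite_of_difference_family[where r = 12 and s = 2 and Bs =
      "[[(0, 0), (11, 1), (5, 9), (0, 22)], [(0, 0), (11, 22), (8, 9), (7, 16)],
       [(0, 0), (7, 22), (4, 21), (11, 16)], [(0, 0), (5, 13), (4, 10), (1, 11)],
       [(0, 0), (1, 1), (8, 10), (5, 23)], [(0, 0), (11, 4), (4, 8), (2, 23)],
       [(0, 0), (7, 4), (8, 8), (10, 11)], [(0, 0), (2, 10), (11, 17), (10, 7)],
       [(0, 0), (10, 10), (7, 5), (2, 19)], [(0, 0), (0, 10), (3, 8), (0, 4)],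
       [(0, 0), (9, 8), (4, 11), (1, 9)], [(0, 0), (3, 18), (5, 14), (2, 4)],
       [(0, 0), (0, 8), (6, 10), (3, 14)], [(0, 0), (11, 5), (11, 6), (0, 21)],
       [(0, 0), (7, 17), (7, 6), (0, 9)], [(0, 0), (8, 7), (6, 6), (2, 11)],
       [(0, 0), (1, 6), (3, 21), (1, 13)], [(0, 0), (5, 6), (3, 9), (5, 1)],
       [(0, 0), (2, 7), (9, 9), (8, 4)], [(0, 0), (10, 19), (9, 21), (4, 4)],
       [(0, 0), (2, 18), (8, 1), (6, 23)], [(0, 0), (10, 18), (4, 13), (6, 11)]]"]) code_simp+
  then show ?thesis by simp
qed

lemma S_multipartite_13: "S_multipartite 13"
proof -
  have "S_multipartite (nat (1 * 13))"
    by (rule S_multipartite_of_difference_family[where r = 1 and s = 24 and Bs =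
      "map (map (Pair 0)) [[0, 305, 218, 213], [0, 41, 194, 45], [0, 161, 290, 93],
       [0, 288, 253, 8], [0, 96, 301, 176], [0, 240, 109, 128], [0, 165, 155, 44],
       [0, 237, 251, 188], [0, 261, 179, 236], [0, 123, 50, 38], [0, 171, 242, 134],
       [0, 291, 98, 62], [0, 86, 167, 53], [0, 254, 47, 269], [0, 206, 215, 29],
       [0, 212, 164, 27], [0, 140, 20, 243], [0, 116, 284, 3], [0, 256, 310, 233],
       [0, 16, 190, 17], [0, 40, 46, 257], [0, 224, 158, 74], [0, 248, 278, 146],
       [0, 152, 110, 170]]"]) code_simp+
  then show ?thesis by simp
qed

lemma S_multipartite_14: "S_multipartite 14"
proof -
  have "S_multipartite (nat (1 * 14))"
    by (rule S_multipartite_of_difference_family[where r = 1 and s = 24 and Bs =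
      "map (map (Pair 0)) [[0, 231, 40, 8], [0, 273, 184, 104], [0, 301, 93, 52],
       [0, 91, 75, 172], [0, 281, 302, 285], [0, 335, 146, 219], [0, 267, 264, 165],
       [0, 216, 228, 66], [0, 53, 22, 9], [0, 227, 202, 159], [0, 289, 157, 54],
       [0, 149, 155, 24], [0, 257, 139, 57], [0, 23, 253, 111], [0, 246, 276, 198],
       [0, 321, 158, 151], [0, 183, 290, 241], [0, 222, 217, 61], [0, 209, 135, 85],
       [0, 71, 33, 307], [0, 143, 291, 272], [0, 137, 213, 176], [0, 318, 259, 115],
       [0, 20, 226, 215], [0, 92, 334, 65], [0, 310, 96, 10]]"]) code_simp+
  then show ?thesis by simp
qed

lemma S_multipartite_15: "S_multipartite 15"
proof -
  have "S_multipartite (nat (1 * 15))"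
    by (rule S_multipartite_of_difference_family[where r = 1 and s = 24 and Bs =
      "map (map (Pair 0)) [[0, 321, 294, 23], [0, 291, 354, 13], [0, 130, 242, 98],
       [0, 200, 331, 79], [0, 193, 138, 86], [0, 203, 78, 346], [0, 309, 342, 314],
       [0, 159, 162, 334], [0, 319, 127, 73], [0, 149, 197, 323], [0, 257, 183, 49],
       [0, 67, 213, 59], [0, 190, 351, 91], [0, 34, 221, 76], [0, 254, 31, 356],
       [0, 158, 196, 25], [0, 58, 236, 155], [0, 70, 343, 307], [0, 47, 256, 179],
       [0, 277, 176, 289], [0, 353, 238, 129], [0, 43, 338, 339], [0, 96, 340, 316],
       [0, 310, 141, 61], [0, 241, 243, 148], [0, 11, 153, 68], [0, 84, 350, 194],
       [0, 272, 344, 40]]"]) code_simp+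
  then show ?thesis by simp
qed

lemma S_multipartite_16: "S_multipartite 16"
proof -
  \<comment> \<open>The group is the product of cyclic groups of orders 8 and 48; the 16 cosets are
    the pairs of residues modulo 4.\<close>
  have "S_multipartite (nat (4 * 4))"
    by (rule S_multipartite_of_difference_family[where r = 2 and s = 12 and Bs =
      "[[(0, 0), (5, 32), (4, 42), (3, 10)], [(0, 0), (7, 43), (1, 34), (0, 45)],
       [(0, 0), (5, 29), (3, 14), (0, 27)], [(0, 0), (1, 21), (5, 3), (2, 0)],
       [(0, 0), (1, 17), (1, 0), (0, 29)], [(0, 0), (3, 7), (3, 0), (0, 43)],
       [(0, 0), (2, 7), (1, 29), (1, 6)], [(0, 0), (6, 17), (3, 43), (3, 42)],
       [(0, 0), (2, 9), (1, 24), (1, 13)], [(0, 0), (6, 15), (3, 24), (3, 11)],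
       [(0, 0), (6, 45), (3, 18), (1, 31)], [(0, 0), (2, 27), (1, 30), (3, 41)],
       [(0, 0), (2, 5), (6, 28), (4, 47)], [(0, 0), (7, 32), (6, 38), (3, 6)],
       [(0, 0), (3, 2), (5, 15), (4, 45)], [(0, 0), (1, 46), (7, 9), (4, 27)],
       [(0, 0), (7, 45), (3, 36), (2, 25)], [(0, 0), (5, 27), (1, 12), (6, 47)],
       [(0, 0), (7, 41), (5, 1), (0, 18)], [(0, 0), (1, 40), (6, 3), (5, 47)],
       [(0, 0), (3, 8), (2, 21), (7, 25)], [(0, 0), (5, 39), (2, 19), (1, 10)],
       [(0, 0), (7, 33), (6, 5), (3, 38)], [(0, 0), (0, 6), (3, 31), (1, 47)],
       [(0, 0), (2, 34), (6, 32), (0, 10)], [(0, 0), (2, 12), (6, 1), (4, 35)],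
       [(0, 0), (3, 26), (3, 40), (2, 18)], [(0, 0), (2, 36), (6, 2), (0, 46)],
       [(0, 0), (0, 9), (6, 40), (6, 7)], [(0, 0), (4, 38), (6, 44), (6, 18)]]"]) code_simp+
  then show ?thesis by simp
qed

lemma S_multipartite_17: "S_multipartite 17"
proof -
  have "S_multipartite (nat (1 * 17))"
    by (rule S_multipartite_of_difference_family[where r = 1 and s = 24 and Bs =
      "map (map (Pair 0)) [[0, 360, 370, 58], [0, 216, 86, 62], [0, 5, 402, 127],
       [0, 343, 78, 389], [0, 29, 210, 247], [0, 31, 126, 53], [0, 271, 21, 8],
       [0, 149, 135, 304], [0, 103, 285, 128], [0, 293, 375, 376], [0, 347, 277, 163],
       [0, 385, 71, 329], [0, 299, 301, 211], [0, 193, 167, 113], [0, 189, 396, 105],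
       [0, 399, 156, 267], [0, 393, 110, 66], [0, 195, 202, 366], [0, 321, 230, 138],
       [0, 315, 274, 246], [0, 290, 365, 191], [0, 310, 151, 373], [0, 50, 77, 47],
       [0, 166, 223, 205], [0, 284, 264, 116], [0, 229, 269, 140], [0, 287, 175, 220],
       [0, 349, 173, 404], [0, 359, 199, 52], [0, 308, 344, 108], [0, 76, 16, 228],
       [0, 214, 288, 142]]"]) code_simp+
  then show ?thesis by simp
qed

lemma S_multipartite_18: "S_multipartite 18"
proof -
  have "S_multipartite (nat (1 * 18))"
    by (rule S_multipartite_of_difference_family[where r = 1 and s = 24 and Bs =
      "map (map (Pair 0)) [[0, 257, 194, 11], [0, 121, 130, 259], [0, 23, 289, 210],
       [0, 31, 89, 114], [0, 184, 66, 10], [0, 345, 19, 6], [0, 33, 251, 102],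
       [0, 319, 430, 354], [0, 167, 110, 402], [0, 364, 85, 51], [0, 284, 77, 219],
       [0, 158, 84, 67], [0, 382, 132, 203], [0, 297, 202, 156], [0, 81, 122, 60],
       [0, 168, 215, 7], [0, 429, 39, 1], [0, 165, 15, 377], [0, 379, 191, 92],
       [0, 323, 295, 124], [0, 247, 147, 20], [0, 239, 123, 196], [0, 237, 223, 98],
       [0, 357, 263, 226], [0, 189, 163, 12], [0, 405, 107, 204], [0, 64, 242, 146],
       [0, 273, 221, 172], [0, 105, 373, 44], [0, 154, 346, 176], [0, 112, 424, 32],
       [0, 272, 387, 155], [0, 48, 344, 328], [0, 133, 408, 5]]"]) code_simp+
  then show ?thesis by simp
qed

lemma S_multipartite_19: "S_multipartite 19"
proof -
  have "S_multipartite (nat (1 * 19))"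
    by (rule S_multipartite_of_difference_family[where r = 1 and s = 24 and Bs =
      "map (map (Pair 0)) [[0, 196, 108, 103], [0, 28, 276, 31], [0, 4, 300, 151],
       [0, 360, 231, 161], [0, 312, 375, 137], [0, 240, 135, 329], [0, 246, 318, 40],
       [0, 198, 78, 136], [0, 126, 174, 280], [0, 334, 444, 23], [0, 406, 324, 215],
       [0, 286, 372, 47], [0, 382, 42, 1], [0, 22, 234, 49], [0, 166, 66, 121],
       [0, 123, 90, 26], [0, 99, 306, 362], [0, 291, 402, 410], [0, 192, 379, 354],
       [0, 288, 331, 18], [0, 432, 259, 426], [0, 68, 39, 7], [0, 140, 87, 343],
       [0, 20, 159, 391], [0, 440, 404, 21], [0, 128, 188, 117], [0, 344, 92, 261],
       [0, 303, 301, 124], [0, 255, 157, 148], [0, 183, 397, 412], [0, 272, 142, 51],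
       [0, 104, 118, 219], [0, 80, 310, 243], [0, 164, 439, 298], [0, 284, 79, 10],
       [0, 236, 223, 34]]"]) code_simp+
  then show ?thesis by simp
qed

text \<open>In the next three lemmas the rotation of order \<open>3\<close> of the Shrikhande graph acts on each base
  block as multiplication by a cube root of unity of the field with \<open>97\<close>, \<open>193\<close> or \<open>289\<close>
  elements. It therefore suffices that representatives of the \<open>16\<close> edge orbits of one block have
  differences in distinct cosets of the subgroup of index \<open>16\<close>; the other blocks are multiples
  of this one.\<close>

lemma S_complete_1: "S_complete 1"
  by (rule S_complete_of_difference_family[where a = 1 and b = 97 and Bs =
    "map (map (Pair 0)) [[0, 1, 19, 23, 61, 29, 3, 86, 92, 50, 83, 8, 45, 4, 43, 35]]"]) code_simp+

lemma S_complete_2: "S_complete 2"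
  by (rule S_complete_of_difference_family[where a = 1 and b = 193 and Bs =
    "map (map (Pair 0)) [[0, 1, 45, 32, 108, 179, 83, 86, 35, 136, 113, 24, 175, 37, 20, 84],
     [0, 49, 82, 24, 81, 86, 14, 161, 171, 102, 133, 18, 83, 76, 15, 63]]"]) code_simp+

lemma S_complete_3: "S_complete 3"
  by (rule S_complete_of_difference_family[where a = 17 and b = 17 and Bs =
    "[[(0, 0), (0, 1), (4, 10), (11, 2), (15, 8), (7, 14), (9, 9), (3, 1), (12, 5), (3, 0),
     (1, 2), (5, 7), (16, 1), (7, 1), (7, 16), (2, 8)], [(0, 0), (16, 2), (15, 8), (3, 5),
     (5, 5), (0, 7), (9, 8), (5, 10), (2, 8), (6, 8), (0, 1), (3, 16), (14, 5), (13, 15),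
     (15, 11), (13, 10)], [(0, 0), (13, 7), (5, 5), (1, 1), (5, 12), (10, 14), (10, 6), (0, 5),
     (13, 10), (4, 15), (16, 2), (7, 6), (6, 2), (11, 8), (2, 11), (16, 15)]]"]) code_simp+

section \<open>Sufficiency\<close>

lemma S_complete_small:
  assumes "k < 4"
  shows "S_complete k"
proof -
  from assms have "k = 0 \<or> k = 1 \<or> k = 2 \<or> k = 3" by linarith
  then show ?thesis using S_complete_0 S_complete_1 S_complete_2 S_complete_3 by blast
qed

lemma S_multipartite_small:
  assumes "4 \<le> t" "t \<le> 19"
  shows "S_multipartite t"
proof -
  from assms have "t \<in> set [4..<20]" unfolding set_upt by simp
  moreover have "\<forall>t\<in>set [4..<20]. S_multipartite t"
    by (simp add: upt_rec_numeral S_multipartite_4 S_multipartite_5 S_multipartite_6 S_multipartite_7 S_multipartite_8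
      S_multipartite_9 S_multipartite_10 S_multipartite_11 S_multipartite_12
      S_multipartite_13 S_multipartite_14 S_multipartite_15 S_multipartite_16
      S_multipartite_17 S_multipartite_18 S_multipartite_19)
  ultimately show ?thesis by blast
qed

lemma S_complete_all: "S_complete k"
proof (induction k rule: less_induct)
  case (less k)
  consider "k < 4" | "4 \<le> k" "k \<le> 19" | "k = 43" | "20 \<le> k" "k \<noteq> 43" by linarith
  then show ?case
  proof cases
    case 1 then show ?thesis using S_complete_small by simp
  next
    case 2 then show ?thesis using S_complete_of_multipartite S_multipartite_small S_complete_1 by simp
  next
    case 3
    \<comment> \<open>The inequalities \<open>4 * m \<le> 43\<close> and
      \<open>43 \<le> 6 * m\<close> leave \<open>m\<close> = 8, 9, 10, none coprime to 6. Instead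
      six full columns of size 7 are used with one point of a seventh.\<close>
    define s :: "nat \<Rightarrow> nat" where "s = (\<lambda>j. if j = 6 then 1 else 7)"
    have "S_complete (\<Sum>j\<le>6. s j)"
    proof (rule S_complete_of_truncated_TD[of 7])
      fix d :: nat assume "0 < d" "d < 6"
      moreover have "\<forall>d\<in>{1, 2, 3, 4, 5}. coprime d (7 :: nat)" by code_simp
      moreover have "d = 1 \<or> d = 2 \<or> d = 3 \<or> d = 4 \<or> d = 5" using calculation(1,2) by linarith
      ultimately show "coprime d 7" by blast
    qed (use less.IH 3 S_multipartite_small in \<open>auto simp: s_def\<close>)
    moreover have "(\<Sum>j\<le>6. s j) = 43" by (simp add: s_def eval_nat_numeral)
    ultimately show ?thesis using 3 by simp
  next
    case 4
    obtain p r where pr: "k = 24 * p + r" "r < 24"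
      by (metis div_mult_mod_eq mod_less_divisor mult.commute zero_less_numeral)
    have cop1: "coprime (6 * n + 1) 6" for n :: nat
      by (intro coprimeI) (metis dvd_add_right_iff dvd_mult2)
    have cop5: "coprime (6 * n + 5) 6" for n :: nat
    proof (intro coprimeI)
      fix d assume "d dvd 6 * n + 5" "d dvd 6"
      then have "d dvd 6 * (n + 1) - (6 * n + 5)" by (intro dvd_diff_nat) auto
      then show "is_unit d" by simp
    qed
    \<comment> \<open>The largest \<open>m\<close> coprime to 6 with \<open>4 * m \<le> k\<close> is
      taken: \<open>6 * p + 5\<close>, \<open>6 * p + 1\<close> or \<open>6 * p - 1\<close>,
      according to \<open>r\<close>.\<close>
    obtain m where m: "coprime m 6" "5 \<le> m" "4 * m \<le> k" "k \<le> 6 * m"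
    proof -
      consider "20 \<le> r" | "r < 20" "4 \<le> r" | "r < 4" by linarith
      then show thesis
      proof cases
        case 1
        show ?thesis using cop5 that[of "6 * p + 5"] pr 1 4 by simp
      next
        case 2
        consider "p = 0" | "p = 1" | "2 \<le> p" by linarith
        \<comment> \<open>\<open>p = 0\<close> would give \<open>k < 20\<close>. For
          \<open>p = 1\<close> the bound is 18, and \<open>r = 19\<close> is the excluded
          \<open>k = 43\<close>.\<close>
        then have "r \<le> 12 * p + 6" using pr 2 4 by cases auto
        then show ?thesis using cop1 that[of "6 * p + 1"] pr 2 4 by simp
      next
        case 3
        then obtain p' where p': "p = Suc p'" using pr 4 by (cases p) auto
        show ?thesis using cop5 that[of "6 * p' + 5"] pr p' 3 4 by simp
      qed
    qed
    \<comment> \<open>The remaining \<open>k - 4 * m \<le> 2 * m\<close> points are split over the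
      two truncated columns.\<close>
    define u where "u = min m (k - 4 * m)"
    define w where "w = k - 4 * m - u"
    define s :: "nat \<Rightarrow> nat" where "s = (\<lambda>j. if j = 4 then u else if j = 5 then w else m)"
    have uw: "u \<le> m" "w \<le> m" "k = 4 * m + u + w" "m < k" using m by (auto simp: u_def w_def)
    have "S_complete (\<Sum>j\<le>5. s j)"
    proof (rule S_complete_of_truncated_TD[of m])
      fix d :: nat assume "0 < d" "d < 5"
      then have "d = 1 \<or> d = 2 \<or> d = 3 \<or> d = 4" by linarith
      \<comment> \<open>36 is used because 4 does not divide 6.\<close>
      then have "d dvd 6 * 6" by auto
      moreover have "coprime (6 * 6) m" using m by (metis coprime_commute coprime_mult_left_iff)
      ultimately show "coprime d m" by (rule coprime_divisors[OF _ dvd_refl])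
    qed (use less.IH uw m S_multipartite_small in \<open>auto simp: s_def\<close>)
    moreover have "(\<Sum>j\<le>5. s j) = k" using uw by (simp add: s_def eval_nat_numeral)
    ultimately show ?thesis by simp
  qed
qed

theorem theorem2p1:
  fixes n :: nat
  assumes "n \<ge> 1"
  shows "has_design shrikhande_V shrikhande_E n \<longleftrightarrow> n mod 96 = 1"
proof
  assume "has_design shrikhande_V shrikhande_E n"
  then show "n mod 96 = 1" using has_design_shrikhande_imp_mod assms by blast
next
  assume "n mod 96 = 1"
  then have "n = 96 * (n div 96) + 1" using mult_div_mod_eq[of 96 n] by simp
  then show "has_design shrikhande_V shrikhande_E n"
    using has_design_of_S_complete[OF S_complete_all] by metis
qed

end
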